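(* For every integer $k\ge 5$, the path $P_5$ on $5$ vertices is $k$-Tur\'an-good.
   Context: All graphs are finite and simple. $P_r$ is the path on $r$ vertices (with $r-1$ edges) and $K_r$ is the complete graph on $r$ vertices. $\mathcal{N}(H,G)$ denotes the number of copies of $H$ in $G$, i.e. the number of (not necessarily induced) subgraphs of $G$ isomorphic to $H$. A graph is $F$-free if it contains no copy of $F$ as a (not necessarily induced) subgraph. $ex(n,H,F)=\max\{\mathcal{N}(H,G): G \text{ is an } n\text{-vertex } F\text{-free graph}\}$. The Tur\'an graph $T_{k-1}(n)$ is the complete $(k-1)$-partite graph on $n$ vertices in which each class has size $\lceil n/(k-1)\rceil$ or $\lfloor n/(k-1)\rfloor$. A graph $H$ that does not contain $K_k$ as a subgraph is called $k$-Tur\'an-good if $ex(n,H,K_k)=\mathcal{N}(H,T_{k-1}(n))$ for every sufficiently large $n$. *)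

theory Defs
  imports Complex_Main
begin

datatype 'a ugraph = UGraph (verts: "'a set") (edges: "'a set set")

definition simple_graph :: "'a ugraph \<Rightarrow> bool" where
  "simple_graph G \<longleftrightarrow> finite (verts G) \<and> (\<forall>e \<in> edges G. e \<subseteq> verts G \<and> card e = 2)"

definition subgraph :: "'a ugraph \<Rightarrow> 'a ugraph \<Rightarrow> bool" where
  "subgraph S G \<longleftrightarrow> simple_graph S \<and> verts S \<subseteq> verts G \<and> edges S \<subseteq> edges G"

definition isomorphic :: "'a ugraph \<Rightarrow> 'b ugraph \<Rightarrow> bool" where
  "isomorphic G H \<longleftrightarrow>
    (\<exists>f. bij_betw f (verts G) (verts H) \<and> (\<lambda>e. f ` e) ` edges G = edges H)"

definition copies :: "'a ugraph \<Rightarrow> 'b ugraph \<Rightarrow> 'b ugraph set" where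
  "copies H G = {S. subgraph S G \<and> isomorphic S H}"

definition num_copies :: "'a ugraph \<Rightarrow> 'b ugraph \<Rightarrow> nat" where
  "num_copies H G = card (copies H G)"

definition free_of :: "'a ugraph \<Rightarrow> 'b ugraph \<Rightarrow> bool" where
  "free_of F G \<longleftrightarrow> copies F G = {}"

text \<open>Every finite graph is isomorphic to one whose vertices are natural numbers, so the
  host graphs may be taken of that type. The set under \<open>Max\<close> is finite (see
  \<open>finite_ex_num_values\<close> below); it is nonempty whenever \<open>F\<close> has an edge.\<close>

definition ex_num :: "nat \<Rightarrow> 'a ugraph \<Rightarrow> 'b ugraph \<Rightarrow> nat" where
  "ex_num n H F =
    Max {num_copies H G | G :: nat ugraph.
           simple_graph G \<and> card (verts G) = n \<and> free_of F G}"

definition complete_graph :: "nat \<Rightarrow> nat ugraph" where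
  "complete_graph r = UGraph {..<r} {e. e \<subseteq> {..<r} \<and> card e = 2}"

definition path_graph :: "nat \<Rightarrow> nat ugraph" where
  "path_graph r = UGraph {..<r} {{i, Suc i} | i. Suc i < r}"

text \<open>The classes are the residue classes modulo \<open>r\<close>; see \<open>is_turan_turan_graph\<close> for the
  usual description.\<close>

definition turan_graph :: "nat \<Rightarrow> nat \<Rightarrow> nat ugraph" where
  "turan_graph r n =
    UGraph {..<n} {{i, j} | i j. i < n \<and> j < n \<and> i mod r \<noteq> j mod r}"

definition turan_good :: "nat \<Rightarrow> 'a ugraph \<Rightarrow> bool" where
  "turan_good k H \<longleftrightarrow> free_of (complete_graph k) H \<and>
    (\<forall>\<^sub>F n in sequentially. ex_num n H (complete_graph k) = num_copies H (turan_graph (k - 1) n))"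

definition is_turan :: "nat \<Rightarrow> nat \<Rightarrow> 'a ugraph \<Rightarrow> bool" where
  "is_turan r n G \<longleftrightarrow> simple_graph G \<and> card (verts G) = n \<and>
    (\<exists>C :: nat \<Rightarrow> 'a set.
      verts G = (\<Union>i<r. C i) \<and>
      (\<forall>i<r. \<forall>j<r. i \<noteq> j \<longrightarrow> C i \<inter> C j = {}) \<and>
      edges G = {{x, y} | x y. \<exists>i<r. \<exists>j<r. i \<noteq> j \<and> x \<in> C i \<and> y \<in> C j} \<and>
      (\<forall>i<r. int (card (C i)) \<in> {\<lceil>real n / real r\<rceil>, \<lfloor>real n / real r\<rfloor>}))"

lemma card_residue_class:
  assumes "i < r"
  shows "card {x. x < n \<and> x mod r = i} = n div r + (if i < n mod r then 1 else 0)"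
proof (induction n)
  case (Suc n)
  have "{x. x < Suc n \<and> x mod r = i} =
      (if n mod r = i then insert n {x. x < n \<and> x mod r = i} else {x. x < n \<and> x mod r = i})"
    by (auto simp: less_Suc_eq)
  moreover have "Suc n mod r = (if Suc (n mod r) = r then 0 else Suc (n mod r))"
    by (rule mod_Suc)
  moreover have "Suc n div r = (if Suc n mod r = 0 then Suc (n div r) else n div r)"
    using div_Suc by auto
  ultimately show ?case
    using Suc assms by auto
qed simp

lemma is_turan_turan_graph:
  assumes "r > 0"
  shows "is_turan r n (turan_graph r n)"
proof -
  define C where "C = (\<lambda>i. {x. x < n \<and> x mod r = i})"
  have size: "int (card (C i)) \<in> {\<lceil>real n / real r\<rceil>, \<lfloor>real n / real r\<rfloor>}" if "i < r" for i
  proof -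
    have fl: "\<lfloor>real n / real r\<rfloor> = int (n div r)"
      by (simp add: floor_divide_of_nat_eq)
    have "\<lceil>real n / real r\<rceil> = int (n div r) + 1" if "n mod r > 0"
    proof -
      have "\<not> r dvd n" using that by (simp add: dvd_eq_mod_eq_0)
      then have "real n / real r \<noteq> of_int \<lfloor>real n / real r\<rfloor>"
        unfolding fl using assms
        by (metis dvd_triv_right nonzero_eq_divide_eq of_int_of_nat_eq of_nat_eq_iff of_nat_mult
            of_nat_0_less_iff order_less_irrefl)
      then show ?thesis
        using fl by (simp add: ceiling_altdef)
    qed
    then show ?thesis
      using card_residue_class[OF that, of n] fl unfolding C_def
      by (cases "i < n mod r") auto
  qed
  have 1: "verts (turan_graph r n) = (\<Union>i<r. C i)"
    using assms by (auto simp: turan_graph_def C_def)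
  have 2: "edges (turan_graph r n) = {{x, y} | x y. \<exists>i<r. \<exists>j<r. i \<noteq> j \<and> x \<in> C i \<and> y \<in> C j}"
    using assms unfolding turan_graph_def C_def
    by simp (metis (lifting) mod_less_divisor)
  have "simple_graph (turan_graph r n)"
    by (auto simp: simple_graph_def turan_graph_def card_2_iff)
  moreover have "card (verts (turan_graph r n)) = n"
    by (simp add: turan_graph_def)
  ultimately show ?thesis
    unfolding is_turan_def using 1 2 size
    by (intro conjI exI[of _ C]) (auto simp: C_def)
qed

lemma finite_ex_num_values:
  "finite {num_copies H G | G :: nat ugraph.
     simple_graph G \<and> card (verts G) = n \<and> free_of F G}"
proof -
  have "num_copies H G \<le> 2 ^ n * 2 ^ (2 ^ n)"
    if G: "simple_graph G" "card (verts G) = n" for G :: "nat ugraph"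
  proof -
    let ?A = "Pow (verts G) \<times> Pow (Pow (verts G))"
    have fin: "finite ?A" using G by (simp add: simple_graph_def)
    have "copies H G \<subseteq> (\<lambda>(W, D). UGraph W D) ` ?A"
    proof
      fix S assume "S \<in> copies H G"
      then have "(verts S, edges S) \<in> ?A"
        using G by (auto simp: copies_def subgraph_def simple_graph_def)
      then show "S \<in> (\<lambda>(W, D). UGraph W D) ` ?A"
        by (rule rev_image_eqI) simp
    qed
    then have "card (copies H G) \<le> card ?A"
      using fin by (rule surj_card_le[rotated])
    also have "\<dots> = 2 ^ n * 2 ^ (2 ^ n)"
      using G by (simp add: card_cartesian_product card_Pow simple_graph_def)
    finally show ?thesis by (simp add: num_copies_def)
  qed
  then show ?thesis
    by (intro finite_subset[OF _ finite_atMost[of "2 ^ n * 2 ^ (2 ^ n)"]]) auto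
qed

end

theory Submission
  imports Defs "HOL-Analysis.Convex"
begin

text \<open>
  Let \<open>r = k - 1\<close>, and take a graph on \<open>n\<close> vertices without \<open>r + 1\<close> pairwise adjacent vertices that
  has the maximal number of five-vertex paths. By Motzkin--Straus the operator
  \<open>C = A / ((1 - 1/r) n)\<close>, where \<open>A\<close> is the adjacency matrix, is a contraction, and as there are at least as
  many paths as in the Turan graph, \<open>C\<^sup>2 1\<close> has almost the norm of the constant vector \<open>1\<close>; a
  second application of Motzkin--Straus, to \<open>1 + C 1\<close>, shows that \<open>C 1\<close> is close to \<open>1\<close>.
  Replacing one vertex by a clone of another shows that all vertices lie on
  almost equally many paths. Since the number of walks through a vertex is governed by its
  degree up to small errors, every degree is at least \<open>(1 - 1/r - \<epsilon>) n\<close>, which forces the graph to be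
  \<open>r\<close>-colourable. So it is contained in a complete \<open>r\<close>-partite graph, and there moving
  a vertex from a class to a smaller one does not decrease the number of paths.
\<close>

section \<open>Weights on graphs with bounded clique number\<close>

text \<open>A path with four edges suits the operator method because the number of walks
  \<open>1^T A^4 1\<close> is the squared norm of \<open>A^2 1\<close>. The obstacle is that a
  symmetric contraction may have eigenvalues near -1, so \<open>C^2 1\<close> close to
  \<open>1\<close> alone says little about \<open>C 1\<close>. As \<open>1 + C 1\<close> is
  nonnegative, Motzkin--Straus bounds its form by the square of its sum, which is sharper than the
  norm bound and excludes this. So far vertices are controlled only in the mean. Single vertices
  come under control in two ways: cloning equalises the numbers of paths through them, and applying
  \<open>C\<close>, whose entries are at most \<open>2 / n\<close>, turns a small mean square into a
  small pointwise error. Every error is an explicit power of one \<open>\<sigma>\<close>: a relative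
  loss \<open>\<sigma>^4\<close> of paths gives mean square errors of order at most
  \<open>\<sigma>^2\<close>, and pointwise errors and a loss of degree of order
  \<open>\<sigma>\<close>. The value \<open>1 / (44 r^3)\<close> makes \<open>11 * \<sigma>\<close>
  the slack \<open>1 / (4 r^3)\<close> that the colouring step tolerates. From the colouring on, all
  estimates are exact.\<close>

definition graph_on :: "'a set \<Rightarrow> ('a \<Rightarrow> 'a \<Rightarrow> bool) \<Rightarrow> bool" where
  "graph_on V A \<longleftrightarrow> finite V \<and> (\<forall>x y. A x y \<longrightarrow> A y x \<and> x \<noteq> y \<and> x \<in> V \<and> y \<in> V)"

definition cliques_le :: "'a set \<Rightarrow> ('a \<Rightarrow> 'a \<Rightarrow> bool) \<Rightarrow> nat \<Rightarrow> bool" where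
  "cliques_le V A r \<longleftrightarrow> (\<forall>X\<subseteq>V. (\<forall>x\<in>X. \<forall>y\<in>X. x \<noteq> y \<longrightarrow> A x y) \<longrightarrow> card X \<le> r)"

definition kernel_op :: "'a set \<Rightarrow> ('a \<Rightarrow> 'a \<Rightarrow> real) \<Rightarrow> ('a \<Rightarrow> real) \<Rightarrow> 'a \<Rightarrow> real" where
  "kernel_op V k y u = (\<Sum>v\<in>V. k u v * y v)"

definition ip :: "'a set \<Rightarrow> ('a \<Rightarrow> real) \<Rightarrow> ('a \<Rightarrow> real) \<Rightarrow> real" where
  "ip V y z = (\<Sum>v\<in>V. y v * z v)"

lemma ip_commute: "ip V y z = ip V z y"
  by (simp add: ip_def mult.commute)

lemma ip_add_left: "ip V (\<lambda>v. y v + z v) w = ip V y w + ip V z w"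
  by (simp add: ip_def algebra_simps sum.distrib)

lemma ip_diff_left: "ip V (\<lambda>v. y v - z v) w = ip V y w - ip V z w"
  by (simp add: ip_def algebra_simps sum_subtractf)

lemma ip_add_right: "ip V w (\<lambda>v. y v + z v) = ip V w y + ip V w z"
  by (simp add: ip_def algebra_simps sum.distrib)

lemma ip_diff_right: "ip V w (\<lambda>v. y v - z v) = ip V w y - ip V w z"
  by (simp add: ip_def algebra_simps sum_subtractf)

lemma kernel_op_add: "kernel_op V k (\<lambda>v. y v + z v) = (\<lambda>u. kernel_op V k y u + kernel_op V k z u)"
  by (rule ext) (simp add: kernel_op_def algebra_simps sum.distrib)

lemma kernel_op_diff: "kernel_op V k (\<lambda>v. y v - z v) = (\<lambda>u. kernel_op V k y u - kernel_op V k z u)"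
  by (rule ext) (simp add: kernel_op_def algebra_simps sum_subtractf)

lemma kernel_op_self_adjoint:
  assumes "\<And>u v. k u v = k v u"
  shows "ip V y (kernel_op V k z) = ip V (kernel_op V k y) z"
proof -
  have "ip V y (kernel_op V k z) = (\<Sum>u\<in>V. \<Sum>v\<in>V. k u v * y u * z v)"
    by (simp add: ip_def kernel_op_def sum_distrib_left algebra_simps)
  also have "\<dots> = (\<Sum>v\<in>V. \<Sum>u\<in>V. k u v * y u * z v)"
    by (rule sum.swap)
  also have "\<dots> = ip V (kernel_op V k y) z"
    using assms by (simp add: ip_def kernel_op_def sum_distrib_left sum_distrib_right algebra_simps)
  finally show ?thesis .
qed

section \<open>The Motzkin--Straus inequality\<close>

lemma Int_singleton: "V \<inter> {w. w = u} = (if u \<in> V then {u} else {})" "V \<inter> {w. u = w} = (if u \<in> V then {u} else {})"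
  by auto

text \<open>On a clique only the diagonal is missing from the form, which is therefore the square of
  the sum minus the sum of squares. Cauchy--Schwarz on at most \<open>r\<close> vertices
  finishes.\<close>

lemma motzkin_straus_clique:
  assumes V: "graph_on V A" and cl: "cliques_le V A r" and r: "r > 0"
    and clique: "\<And>u v. u \<in> V \<Longrightarrow> v \<in> V \<Longrightarrow> x u \<noteq> 0 \<Longrightarrow> x v \<noteq> 0 \<Longrightarrow> u \<noteq> v \<Longrightarrow> A u v"
  shows "ip V x (kernel_op V (\<lambda>u v. of_bool (A u v)) x) \<le> (1 - 1 / real r) * (\<Sum>v\<in>V. x v)\<^sup>2"
proof -
  define S where "S = {v \<in> V. x v \<noteq> 0}"
  have fin: "finite V" and SV: "S \<subseteq> V" and irr: "\<not> A u u" for u using V by (auto simp: graph_on_def S_def)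
  then have finS: "finite S" using finite_subset by blast
  have cS: "card S \<le> r" using cl clique unfolding cliques_le_def S_def by auto
  have "ip V x (kernel_op V (\<lambda>u v. of_bool (A u v)) x) = (\<Sum>u\<in>V. \<Sum>v\<in>V. x u * x v - of_bool (u = v) * x u * x v)"
    unfolding ip_def kernel_op_def sum_distrib_left
  proof (intro sum.cong refl)
    fix u v assume "u \<in> V" "v \<in> V"
    then show "x u * (of_bool (A u v) * x v) = x u * x v - of_bool (u = v) * x u * x v"
      using clique[of u v] irr[of u] by (cases "x u = 0"; cases "x v = 0"; cases "u = v") simp_all
  qed
  also have "\<dots> = (\<Sum>v\<in>V. x v)\<^sup>2 - (\<Sum>u\<in>V. (x u)\<^sup>2)"
    using fin by (simp add: sum_subtractf power2_eq_square sum_product mult.assoc Int_singleton)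
  also have "(\<Sum>v\<in>V. x v) = (\<Sum>v\<in>S. x v)"
    by (rule sum.mono_neutral_right) (use fin in \<open>auto simp: S_def\<close>)
  also have "(\<Sum>u\<in>V. (x u)\<^sup>2) = (\<Sum>u\<in>S. (x u)\<^sup>2)"
    by (rule sum.mono_neutral_right) (use fin in \<open>auto simp: S_def\<close>)
  finally have *: "ip V x (kernel_op V (\<lambda>u v. of_bool (A u v)) x) = (\<Sum>v\<in>S. x v)\<^sup>2 - (\<Sum>u\<in>S. (x u)\<^sup>2)" .
  have "(\<Sum>v\<in>S. x v)\<^sup>2 \<le> (\<Sum>u\<in>S. (x u)\<^sup>2) * card S"
    using sum_squared_le_sum_of_squares[of x S] finS by simp
  also have "\<dots> \<le> (\<Sum>u\<in>S. (x u)\<^sup>2) * r"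
    by (intro mult_left_mono) (use cS in \<open>auto intro: sum_nonneg\<close>)
  finally have "(\<Sum>v\<in>S. x v)\<^sup>2 / r \<le> (\<Sum>u\<in>S. (x u)\<^sup>2)"
    using r by (simp add: divide_le_eq)
  moreover have "(\<Sum>v\<in>S. x v) = (\<Sum>v\<in>V. x v)"
    by (rule sum.mono_neutral_left) (use fin in \<open>auto simp: S_def\<close>)
  ultimately show ?thesis
    using * by (simp add: algebra_simps)
qed

text \<open>Symmetrisation: of two nonadjacent vertices in the support, the one with the smaller
  weighted neighbourhood hands its whole weight to the other. The form does not drop and the support
  shrinks, until it is a clique.\<close>

lemma motzkin_straus:
  assumes V: "graph_on V A" and cl: "cliques_le V A r" and r: "r > 0"
    and "\<And>v. v \<in> V \<Longrightarrow> x v \<ge> 0"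
  shows "ip V x (kernel_op V (\<lambda>u v. of_bool (A u v)) x) \<le> (1 - 1 / real r) * (\<Sum>v\<in>V. x v)\<^sup>2"
  using assms(4)
proof (induction "card {v \<in> V. x v \<noteq> 0}" arbitrary: x rule: less_induct)
  case less
  let ?k = "\<lambda>u v. of_bool (A u v) :: real"
  have fin: "finite V" using V by (simp add: graph_on_def)
  have sym: "?k u v = ?k v u" for u v using V by (auto simp: graph_on_def)
  show ?case
  proof (cases "\<exists>u\<in>V. \<exists>v\<in>V. x u \<noteq> 0 \<and> x v \<noteq> 0 \<and> u \<noteq> v \<and> \<not> A u v")
    case False
    show ?thesis
    proof (rule motzkin_straus_clique[OF V cl r])
      fix u v assume "u \<in> V" "v \<in> V" "x u \<noteq> 0" "x v \<noteq> 0" "u \<noteq> v"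
      with False show "A u v" by meson
    qed
  next
    case True
    then obtain u' v' where uv': "u' \<in> V" "v' \<in> V" "x u' \<noteq> 0" "x v' \<noteq> 0" "u' \<noteq> v'" "\<not> A u' v'"
      by meson
    have "\<not> A v' u'" using V uv' unfolding graph_on_def by meson
    with uv' obtain u v where uv: "u \<in> V" "v \<in> V" "x u \<noteq> 0" "x v \<noteq> 0" "u \<noteq> v" "\<not> A u v"
        "kernel_op V ?k x u \<ge> kernel_op V ?k x v"
      using linorder_le_cases[of "kernel_op V ?k x u'" "kernel_op V ?k x v'"] by metis
    \<comment> \<open>The direction that shifts the weight of \<open>v\<close> to \<open>u\<close>.
      Since \<open>u\<close> and \<open>v\<close> are nonadjacent, the form has no quadratic term
      along \<open>d\<close>, so only the comparison of the two neighbourhood weights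
      matters.\<close>
    define d where "d = (\<lambda>w. x v * (of_bool (w = u) - of_bool (w = v)))"
    define y where "y = (\<lambda>w. x w + d w)"
    have y: "y u = x u + x v" "y v = 0" "\<And>w. w \<noteq> u \<Longrightarrow> w \<noteq> v \<Longrightarrow> y w = x w"
      using uv by (auto simp: y_def d_def)
    have ipd: "ip V d z = x v * (z u - z v)" for z
    proof -
      have "ip V d z = x v * (\<Sum>w\<in>V. of_bool (w = u) * z w - of_bool (w = v) * z w)"
        unfolding ip_def d_def sum_distrib_left by (intro sum.cong refl) (simp only: algebra_simps)
      also have "(\<Sum>w\<in>V. of_bool (w = u) * z w - of_bool (w = v) * z w) = z u - z v"
        using fin uv by (simp add: sum_subtractf Int_singleton)
      finally show ?thesis .
    qed
    have kd: "kernel_op V ?k d w = x v * (?k w u - ?k w v)" for w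
      using ipd[of "?k w"] by (simp add: kernel_op_def ip_def mult.commute)
    have irr: "\<not> A u u" "\<not> A v v" "\<not> A v u" using V uv by (auto simp: graph_on_def)
    have "ip V y (kernel_op V ?k y) = ip V x (kernel_op V ?k x) + ip V x (kernel_op V ?k d)
        + ip V d (kernel_op V ?k x) + ip V d (kernel_op V ?k d)"
      unfolding y_def by (simp add: kernel_op_add ip_add_left ip_add_right)
    also have "ip V x (kernel_op V ?k d) = ip V d (kernel_op V ?k x)"
      by (subst kernel_op_self_adjoint[OF sym]) (rule ip_commute)
    also have "ip V d (kernel_op V ?k d) = 0"
      using irr uv by (simp add: ipd kd)
    finally have "ip V x (kernel_op V ?k x) \<le> ip V y (kernel_op V ?k y)"
      using uv less.prems[of v] by (simp add: ipd)
    also have "\<dots> \<le> (1 - 1 / real r) * (\<Sum>v\<in>V. y v)\<^sup>2"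
    proof (rule less.hyps)
      have "{w \<in> V. y w \<noteq> 0} \<subset> {v \<in> V. x v \<noteq> 0}"
        using y uv by force
      then show "card {w \<in> V. y w \<noteq> 0} < card {v \<in> V. x v \<noteq> 0}"
        using fin by (intro psubset_card_mono) auto
      show "0 \<le> y w" if "w \<in> V" for w
        using less.prems[OF that] less.prems[of u] less.prems[of v] uv y by (cases "w = u"; cases "w = v") auto
    qed
    also have "(\<Sum>v\<in>V. y v) = (\<Sum>v\<in>V. x v)"
      using ipd[of "\<lambda>_. 1"] by (simp add: y_def sum.distrib ip_def)
    finally show ?thesis .
  qed
qed

section \<open>Norm bounds for symmetric nonnegative kernels\<close>

lemma ip_self_nonneg: "ip V y y \<ge> 0"
  by (simp add: ip_def sum_nonneg)

text \<open>As the kernel is nonnegative, the form at \<open>y\<close> is dominated by the form at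
  \<open>\<bar>y\<bar>\<close>, where \<open>ms\<close> and Cauchy--Schwarz apply. For a symmetric
  operator a bound on the form is a bound on the norm.\<close>

lemma kernel_op_contraction:
  assumes fin: "finite V" and sym: "\<And>u v. k u v = k v u" and nn: "\<And>u v. k u v \<ge> 0"
    and ms: "\<And>y. (\<And>v. y v \<ge> 0) \<Longrightarrow> ip V y (kernel_op V k y) \<le> (\<Sum>v\<in>V. y v)\<^sup>2 / card V"
  shows "ip V (kernel_op V k y) (kernel_op V k y) \<le> ip V y y"
proof -
  have Q: "\<bar>ip V y (kernel_op V k y)\<bar> \<le> ip V y y" for y
  proof -
    have "\<bar>ip V y (kernel_op V k y)\<bar> \<le> (\<Sum>u\<in>V. \<bar>y u * kernel_op V k y u\<bar>)"
      unfolding ip_def by (rule sum_abs)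
    also have "\<dots> \<le> ip V (\<lambda>v. \<bar>y v\<bar>) (kernel_op V k (\<lambda>v. \<bar>y v\<bar>))"
      unfolding ip_def
    proof (rule sum_mono)
      fix u assume "u \<in> V"
      have "\<bar>kernel_op V k y u\<bar> \<le> (\<Sum>v\<in>V. \<bar>k u v * y v\<bar>)" unfolding kernel_op_def by (rule sum_abs)
      also have "\<dots> = kernel_op V k (\<lambda>v. \<bar>y v\<bar>) u" using nn by (simp add: kernel_op_def abs_mult)
      finally show "\<bar>y u * kernel_op V k y u\<bar> \<le> \<bar>y u\<bar> * kernel_op V k (\<lambda>v. \<bar>y v\<bar>) u"
        by (simp add: abs_mult mult_left_mono)
    qed
    also have "\<dots> \<le> (\<Sum>v\<in>V. \<bar>y v\<bar>)\<^sup>2 / card V" by (rule ms) simp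
    also have "\<dots> \<le> (\<Sum>v\<in>V. \<bar>y v\<bar>\<^sup>2)"
    proof (cases "card V = 0")
      case False
      then show ?thesis
        using sum_squared_le_sum_of_squares[of "\<lambda>v. \<bar>y v\<bar>" V] fin by (simp add: divide_le_eq)
    qed (simp add: sum_nonneg)
    also have "\<dots> = ip V y y" by (simp add: ip_def power2_eq_square)
    finally show ?thesis .
  qed
  let ?z = "kernel_op V k y"
  \<comment> \<open>Polarisation: with \<open>?z\<close> the image of \<open>y\<close>, the
    difference of the forms at \<open>?z + y\<close> and \<open>?z - y\<close> is four times the
    squared norm of \<open>?z\<close>.\<close>
  have "ip V (\<lambda>v. ?z v + y v) (kernel_op V k (\<lambda>v. ?z v + y v)) - ip V (\<lambda>v. ?z v - y v) (kernel_op V k (\<lambda>v. ?z v - y v))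
     = 2 * ip V ?z ?z + 2 * ip V y (kernel_op V k ?z)"
    by (simp add: kernel_op_add kernel_op_diff ip_add_left ip_add_right ip_diff_left ip_diff_right)
  also have "ip V y (kernel_op V k ?z) = ip V ?z ?z" by (rule kernel_op_self_adjoint[OF sym])
  finally have "4 * ip V ?z ?z \<le> ip V (\<lambda>v. ?z v + y v) (\<lambda>v. ?z v + y v) + ip V (\<lambda>v. ?z v - y v) (\<lambda>v. ?z v - y v)"
    using Q[of "\<lambda>v. ?z v + y v"] Q[of "\<lambda>v. ?z v - y v"] by linarith
  also have "\<dots> = 2 * ip V ?z ?z + 2 * ip V y y"
    by (simp add: ip_add_left ip_add_right ip_diff_left ip_diff_right ip_commute)
  finally show ?thesis by simp
qed

text \<open>The squared norms of \<open>1\<close>, \<open>a\<close>, \<open>b\<close> decrease and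
  all lie between \<open>(1 - \<theta>^2) n\<close> and \<open>n\<close>. As the inner product of
  \<open>1\<close> and \<open>b\<close> is the squared norm of \<open>a\<close>, this puts
  \<open>b\<close> near \<open>1\<close>. For \<open>a\<close> it remains to show that its sum is
  nearly \<open>n\<close>, which takes the test vector \<open>1 + a\<close>.\<close>

lemma kernel_op_almost_fixes_one:
  fixes V :: "'a set" and k :: "'a \<Rightarrow> 'a \<Rightarrow> real" and \<theta> :: real and a b :: "'a \<Rightarrow> real"
  assumes fin: "finite V" and n: "card V > 0" and sym: "\<And>u v. k u v = k v u" and nn: "\<And>u v. k u v \<ge> 0"
    and ms: "\<And>y. (\<And>v. y v \<ge> 0) \<Longrightarrow> ip V y (kernel_op V k y) \<le> (\<Sum>v\<in>V. y v)\<^sup>2 / card V"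
    and th: "0 < \<theta>" "\<theta> \<le> 1"
    and a: "a = kernel_op V k (\<lambda>_. 1)" and b: "b = kernel_op V k a"
    and big: "ip V b b \<ge> (1 - \<theta>\<^sup>2) * card V"
  shows "ip V (\<lambda>v. 1 - a v) (\<lambda>v. 1 - a v) \<le> 6 * \<theta> * card V"
    and "ip V (\<lambda>v. 1 - b v) (\<lambda>v. 1 - b v) \<le> \<theta>\<^sup>2 * card V"
proof -
  note contr = kernel_op_contraction[OF fin sym nn ms]
  let ?o = "\<lambda>_. 1 :: real" let ?n = "real (card V)"
  have oo: "ip V ?o ?o = ?n" by (simp add: ip_def)
  have aa: "ip V a a \<le> ?n" using contr[of ?o] oo a by simp
  have bb: "ip V b b \<le> ip V a a" using contr[of a] b by simp
  have ob: "ip V ?o b = ip V a a" using kernel_op_self_adjoint[OF sym, where V=V and y = ?o and z = a] a b by simp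
  have 1: "ip V (\<lambda>v. 1 - b v) (\<lambda>v. 1 - b v) = ?n - 2 * ip V a a + ip V b b"
    using oo ob ip_commute[of V b ?o] by (simp add: ip_diff_left ip_diff_right)
  then show 2: "ip V (\<lambda>v. 1 - b v) (\<lambda>v. 1 - b v) \<le> \<theta>\<^sup>2 * ?n"
    using big bb by (simp add: algebra_simps)
  let ?c = "ip V ?o a"
  have oa: "?c = (\<Sum>v\<in>V. a v)" by (simp add: ip_def)
  have an: "a v \<ge> 0" for v using nn a by (simp add: kernel_op_def sum_nonneg)
  have c0: "?c \<ge> 0" using an oa by (simp add: sum_nonneg)
  have cn: "?c \<le> ?n" using ms[of ?o] a n by (simp add: power2_eq_square)
  \<comment> \<open>The arithmetic-geometric mean inequality with weight \<open>\<theta>\<close>,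
    which balances \<open>a\<close> of squared norm at most \<open>n\<close> against
    \<open>1 - b\<close> of squared norm at most \<open>\<theta>^2 n\<close>.\<close>
  have amgm: "ip V a (\<lambda>v. 1 - b v) \<le> \<theta> * ?n"
  proof -
    have "0 \<le> ip V (\<lambda>v. \<theta> * a v - (1 - b v)) (\<lambda>v. \<theta> * a v - (1 - b v))" by (rule ip_self_nonneg)
    also have "\<dots> = \<theta>\<^sup>2 * ip V a a - 2 * \<theta> * ip V a (\<lambda>v. 1 - b v) + ip V (\<lambda>v. 1 - b v) (\<lambda>v. 1 - b v)"
      by (simp add: ip_def sum_distrib_left sum.distrib[symmetric] sum_subtractf[symmetric]
          power2_eq_square algebra_simps)
    also have "\<dots> \<le> \<theta>\<^sup>2 * ?n - 2 * \<theta> * ip V a (\<lambda>v. 1 - b v) + \<theta>\<^sup>2 * ?n"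
      using 2 aa th by (intro add_mono diff_mono mult_left_mono) auto
    finally have "2 * \<theta> * ip V a (\<lambda>v. 1 - b v) \<le> 2 * \<theta> * (\<theta> * ?n)"
      by (simp add: power2_eq_square algebra_simps)
    then show ?thesis using th by simp
  qed
  \<comment> \<open>With \<open>?c\<close> the sum of \<open>a\<close>, both \<open>ip V a a\<close>
    near \<open>n\<close> and \<open>ip V a b\<close> near \<open>?c\<close>, this inequality reads
    roughly \<open>2 n + ?c \<le> n + 2 * ?c\<close>, so \<open>?c\<close> cannot be much below
    \<open>n\<close>.\<close>
  have "ip V (\<lambda>v. 1 + a v) (kernel_op V k (\<lambda>v. 1 + a v)) \<le> (\<Sum>v\<in>V. 1 + a v)\<^sup>2 / ?n"
    by (rule ms) (use an in \<open>simp add: add_nonneg_nonneg\<close>)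
  also have "ip V (\<lambda>v. 1 + a v) (kernel_op V k (\<lambda>v. 1 + a v)) = ?c + ip V ?o b + ip V a a + ip V a b"
    using a b by (simp add: kernel_op_add ip_add_left ip_add_right)
  also have "(\<Sum>v\<in>V. 1 + a v)\<^sup>2 / ?n = ?n + 2 * ?c + ?c\<^sup>2 / ?n"
    using n by (simp add: sum.distrib oa power2_eq_square field_simps)
  finally have "2 * ip V a a + ip V a b \<le> ?n + ?c + ?c\<^sup>2 / ?n" using ob by simp
  moreover have "ip V a b \<ge> ?c - \<theta> * ?n"
    using amgm ip_commute[of V a ?o] by (simp add: ip_diff_right)
  moreover have "?c\<^sup>2 / ?n \<le> ?c"
    using cn c0 n by (simp add: power2_eq_square divide_le_eq mult_left_mono)
  moreover have "\<theta>\<^sup>2 * ?n \<le> \<theta> * ?n"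
    using th by (intro mult_right_mono) (auto simp: power2_eq_square mult_le_cancel_left1)
  ultimately have "?c \<ge> ?n - 3 * (\<theta> * ?n)"
    using bb big by (simp add: algebra_simps)
  moreover have "ip V (\<lambda>v. 1 - a v) (\<lambda>v. 1 - a v) = ?n - 2 * ?c + ip V a a"
    using oo ip_commute[of V a ?o] by (simp add: ip_diff_left ip_diff_right)
  ultimately show "ip V (\<lambda>v. 1 - a v) (\<lambda>v. 1 - a v) \<le> 6 * \<theta> * ?n"
    using aa by simp
qed

section \<open>Paths on five vertices and walks\<close>

text \<open>Ordered tuples, so every path is counted once in each direction.\<close>

definition paths5 :: "('a \<Rightarrow> 'a \<Rightarrow> bool) \<Rightarrow> ('a \<times> 'a \<times> 'a \<times> 'a \<times> 'a) set" where
  "paths5 A = {(a, b, c, d, e). A a b \<and> A b c \<and> A c d \<and> A d e \<and> distinct [a, b, c, d, e]}"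

definition through :: "('a \<Rightarrow> 'a \<Rightarrow> bool) \<Rightarrow> 'a \<Rightarrow> ('a \<times> 'a \<times> 'a \<times> 'a \<times> 'a) set" where
  "through A v = {(a, b, c, d, e) \<in> paths5 A. v \<in> {a, b, c, d, e}}"

lemma card_5tuples:
  assumes "finite V" "\<And>a b c d e. Q a b c d e \<Longrightarrow> a \<in> V \<and> b \<in> V \<and> c \<in> V \<and> d \<in> V \<and> e \<in> V"
  shows "real (card {(a, b, c, d, e). Q a b c d e}) =
    (\<Sum>a\<in>V. \<Sum>b\<in>V. \<Sum>c\<in>V. \<Sum>d\<in>V. \<Sum>e\<in>V. of_bool (Q a b c d e))"
proof -
  have *: "{(a, b, c, d, e). Q a b c d e} = (V \<times> V \<times> V \<times> V \<times> V) \<inter> {(a, b, c, d, e). Q a b c d e}"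
    using assms(2) by blast
  have "(\<Sum>a\<in>V. \<Sum>b\<in>V. \<Sum>c\<in>V. \<Sum>d\<in>V. \<Sum>e\<in>V. of_bool (Q a b c d e) :: real) =
      (\<Sum>t\<in>V \<times> V \<times> V \<times> V \<times> V. of_bool (t \<in> {(a, b, c, d, e). Q a b c d e}))"
    by (simp only: sum.cartesian_product) (auto intro!: sum.cong)
  also have "\<dots> = real (card ((V \<times> V \<times> V \<times> V \<times> V) \<inter> {(a, b, c, d, e). Q a b c d e}))"
    using assms(1) by (subst sum_of_bool_eq) (auto simp del: mem_Collect_eq simp: Collect_mem_eq)
  finally show ?thesis using * by simp
qed

lemma paths5_subset:
  assumes "graph_on V A" "(a, b, c, d, e) \<in> paths5 A"
  shows "{a, b, c, d, e} \<subseteq> V"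
proof -
  have "x \<in> V" "y \<in> V" if "A x y" for x y using assms(1) that unfolding graph_on_def by blast+
  with assms(2) show ?thesis by (auto simp: paths5_def)
qed

lemma finite_paths5: "graph_on V A \<Longrightarrow> finite (paths5 A)"
  by (rule finite_subset[of _ "V \<times> V \<times> V \<times> V \<times> V"]) (auto simp: graph_on_def paths5_def)

lemma sum_card_through:
  assumes "graph_on V A"
  shows "(\<Sum>v\<in>V. card (through A v)) = 5 * card (paths5 A)"
proof -
  have fin: "finite V" using assms by (simp add: graph_on_def)
  have finp: "finite (paths5 A)" using finite_paths5[OF assms] .
  let ?s = "\<lambda>(a, b, c, d, e). {a, b, c, d, e}"
  have "through A v = {t \<in> paths5 A. v \<in> ?s t}" for v
    by (auto simp: through_def)
  then have "(\<Sum>v\<in>V. card (through A v)) = (\<Sum>v\<in>V. card {t \<in> paths5 A. v \<in> ?s t})" by simp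
  also have "\<dots> = (\<Sum>v\<in>V. \<Sum>t\<in>paths5 A. of_bool (v \<in> ?s t))"
    using finp by (simp add: Int_def)
  also have "\<dots> = (\<Sum>t\<in>paths5 A. \<Sum>v\<in>V. of_bool (v \<in> ?s t))"
    by (rule sum.swap)
  also have "\<dots> = (\<Sum>t\<in>paths5 A. 5)"
  proof (rule sum.cong[OF refl])
    fix t assume t: "t \<in> paths5 A"
    then have "?s t \<subseteq> V" "card (?s t) = 5"
      using assms by (auto simp: paths5_def graph_on_def)
    then have "card (V \<inter> {v. v \<in> ?s t}) = 5" by (simp add: Int_absorb1)
    then show "(\<Sum>v\<in>V. of_bool (v \<in> ?s t)) = (5 :: nat)" using fin by simp
  qed
  finally show ?thesis by simp
qed

text \<open>Forgetting distinctness leaves walks with four edges; moving two of the four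
  applications of \<open>K\<close> to the other side of the inner product makes their number a
  squared norm.\<close>

lemma card_paths5_le_walks:
  assumes "graph_on V A" and K: "K = (\<lambda>u v. of_bool (A u v))"
  shows "real (card (paths5 A)) \<le> ip V (kernel_op V K (kernel_op V K (\<lambda>_. 1))) (kernel_op V K (kernel_op V K (\<lambda>_. 1)))"
proof -
  have fin: "finite V" using assms by (simp add: graph_on_def)
  have sym: "K u v = K v u" for u v using assms by (auto simp: graph_on_def)
  have "real (card (paths5 A)) =
      (\<Sum>a\<in>V. \<Sum>b\<in>V. \<Sum>c\<in>V. \<Sum>d\<in>V. \<Sum>e\<in>V. of_bool (A a b \<and> A b c \<and> A c d \<and> A d e \<and> distinct [a, b, c, d, e]))"
    unfolding paths5_def
    by (rule card_5tuples[OF fin]) (use assms in \<open>auto simp: graph_on_def\<close>)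
  also have "\<dots> \<le> (\<Sum>a\<in>V. \<Sum>b\<in>V. \<Sum>c\<in>V. \<Sum>d\<in>V. \<Sum>e\<in>V. K a b * (K b c * (K c d * (K d e * 1))))"
    unfolding K by (intro sum_mono) auto
  also have "\<dots> = ip V (\<lambda>_. 1) (kernel_op V K (kernel_op V K (kernel_op V K (kernel_op V K (\<lambda>_. 1)))))"
    by (simp add: kernel_op_def ip_def sum_distrib_left)
  also have "\<dots> = ip V (kernel_op V K (kernel_op V K (\<lambda>_. 1))) (kernel_op V K (kernel_op V K (\<lambda>_. 1)))"
    by (simp add: kernel_op_self_adjoint[OF sym])
  finally show ?thesis .
qed

text \<open>A walk is cut at \<open>v\<close>: each end position contributes \<open>w4 v\<close>,
  the second and the fourth \<open>w1 v * w3 v\<close>, the middle one the square of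
  \<open>w2 v\<close>.\<close>

lemma card_through_le_walks:
  assumes "graph_on V A" and K: "K = (\<lambda>u v. of_bool (A u v))" and v: "v \<in> V"
    and w: "w1 = kernel_op V K (\<lambda>_. 1)" "w2 = kernel_op V K w1" "w3 = kernel_op V K w2" "w4 = kernel_op V K w3"
  shows "real (card (through A v)) \<le> 2 * w4 v + 2 * w1 v * w3 v + (w2 v)\<^sup>2"
proof -
  have fin: "finite V" using assms by (simp add: graph_on_def)
  have sym: "K u v = K v u" for u v using assms by (auto simp: graph_on_def)
  \<comment> \<open>The indicator is inserted into the iterated operator at the place of
    \<open>v\<close>. Self-adjointness moves the operators in front of it onto the constant vector,
    and \<open>ipi\<close> evaluates the product at \<open>v\<close>.\<close>
  let ?i = "\<lambda>x. of_bool (x = v) :: real"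
  let ?S = "\<lambda>f. \<Sum>a\<in>V. \<Sum>b\<in>V. \<Sum>c\<in>V. \<Sum>d\<in>V. \<Sum>e\<in>V. f a b c d e :: real"
  have ipi: "ip V y (\<lambda>x. ?i x * z x) = y v * z v" for y z
    using fin v by (simp add: ip_def Int_singleton mult.left_commute[of _ "of_bool _"])
  have "real (card (through A v)) =
      ?S (\<lambda>a b c d e. of_bool ((A a b \<and> A b c \<and> A c d \<and> A d e \<and> distinct [a, b, c, d, e]) \<and> v \<in> {a, b, c, d, e}))"
  proof -
    have "through A v = {(a, b, c, d, e). (A a b \<and> A b c \<and> A c d \<and> A d e \<and> distinct [a, b, c, d, e]) \<and> v \<in> {a, b, c, d, e}}"
      by (auto simp: through_def paths5_def)
    then show ?thesis
      by (simp only:) (rule card_5tuples[OF fin], use assms(1) in \<open>auto simp: graph_on_def\<close>)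
  qed
  also have "\<dots> \<le> ?S (\<lambda>a b c d e. ?i a * (K a b * (K b c * (K c d * (K d e * 1))))
      + K a b * (?i b * (K b c * (K c d * (K d e * 1))))
      + K a b * (K b c * (?i c * (K c d * (K d e * 1))))
      + K a b * (K b c * (K c d * (?i d * (K d e * 1))))
      + K a b * (K b c * (K c d * (K d e * (?i e * 1)))))"
    unfolding K by (intro sum_mono) auto
  also have "\<dots> = ?S (\<lambda>a b c d e. ?i a * (K a b * (K b c * (K c d * (K d e * 1)))))
      + ?S (\<lambda>a b c d e. K a b * (?i b * (K b c * (K c d * (K d e * 1)))))
      + ?S (\<lambda>a b c d e. K a b * (K b c * (?i c * (K c d * (K d e * 1)))))
      + ?S (\<lambda>a b c d e. K a b * (K b c * (K c d * (?i d * (K d e * 1)))))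
      + ?S (\<lambda>a b c d e. K a b * (K b c * (K c d * (K d e * (?i e * 1)))))"
    by (simp only: sum.distrib)
  also have "?S (\<lambda>a b c d e. ?i a * (K a b * (K b c * (K c d * (K d e * 1))))) = ip V (\<lambda>_. 1) (\<lambda>x. ?i x * w4 x)"
    by (simp only: w kernel_op_def ip_def sum_distrib_left mult_1_left)
  also have "\<dots> = w4 v" by (simp only: ipi mult_1_left)
  also have "?S (\<lambda>a b c d e. K a b * (?i b * (K b c * (K c d * (K d e * 1))))) = ip V (\<lambda>_. 1) (kernel_op V K (\<lambda>x. ?i x * w3 x))"
    by (simp only: w kernel_op_def ip_def sum_distrib_left mult_1_left)
  also have "\<dots> = w1 v * w3 v" unfolding kernel_op_self_adjoint[OF sym] w(1)[symmetric] ipi ..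
  also have "?S (\<lambda>a b c d e. K a b * (K b c * (?i c * (K c d * (K d e * 1))))) = ip V (\<lambda>_. 1) (kernel_op V K (kernel_op V K (\<lambda>x. ?i x * w2 x)))"
    by (simp only: w kernel_op_def ip_def sum_distrib_left mult_1_left)
  also have "\<dots> = w2 v * w2 v" unfolding kernel_op_self_adjoint[OF sym] w(1)[symmetric] w(2)[symmetric] ipi ..
  also have "?S (\<lambda>a b c d e. K a b * (K b c * (K c d * (?i d * (K d e * 1))))) = ip V (\<lambda>_. 1) (kernel_op V K (kernel_op V K (kernel_op V K (\<lambda>x. ?i x * w1 x))))"
    by (simp only: w kernel_op_def ip_def sum_distrib_left mult_1_left)
  also have "\<dots> = w3 v * w1 v" unfolding kernel_op_self_adjoint[OF sym] w(1)[symmetric] w(2)[symmetric] w(3)[symmetric] ipi ..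
  also have "?S (\<lambda>a b c d e. K a b * (K b c * (K c d * (K d e * (?i e * 1))))) = ip V (\<lambda>_. 1) (kernel_op V K (kernel_op V K (kernel_op V K (kernel_op V K (\<lambda>x. ?i x * 1)))))"
    by (simp only: w kernel_op_def ip_def sum_distrib_left mult_1_left)
  also have "\<dots> = w4 v * 1" unfolding kernel_op_self_adjoint[OF sym] w(1)[symmetric] w(2)[symmetric] w(3)[symmetric] w(4)[symmetric] ipi ..
  finally show ?thesis by (simp add: power2_eq_square algebra_simps)
qed

text \<open>Entries of size at most \<open>2 / n\<close> make the value at most twice the mean of
  \<open>\<bar>y\<bar>\<close>, hence at most \<open>2 * sqrt 6 * \<sigma>\<close> by
  Cauchy--Schwarz; the proof uses \<open>5 / 2\<close> as a bound for \<open>sqrt 6\<close>.\<close>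

lemma kernel_op_pointwise:
  fixes V :: "'a set" and k :: "'a \<Rightarrow> 'a \<Rightarrow> real" and \<sigma> :: real
  assumes k: "\<And>u v. \<bar>k u v\<bar> \<le> c" and c: "c * card V \<le> 2"
    and y: "ip V y y \<le> 6 * \<sigma>\<^sup>2 * card V" and s: "\<sigma> \<ge> 0"
  shows "\<bar>kernel_op V k y v\<bar> \<le> 5 * \<sigma>"
proof -
  let ?n = "real (card V)"
  have c0: "c \<ge> 0" using k[of v v] by linarith
  have "\<bar>kernel_op V k y v\<bar> \<le> (\<Sum>u\<in>V. \<bar>k v u * y u\<bar>)" unfolding kernel_op_def by (rule sum_abs)
  also have "\<dots> \<le> (\<Sum>u\<in>V. c * \<bar>y u\<bar>)"
    using k by (intro sum_mono) (auto simp: abs_mult intro: mult_right_mono)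
  also have "\<dots> = c * (\<Sum>u\<in>V. \<bar>y u\<bar>)" by (simp add: sum_distrib_left)
  also have "(\<Sum>u\<in>V. \<bar>y u\<bar>) \<le> 5 / 2 * \<sigma> * ?n"
  proof (rule power2_le_imp_le)
    have "(\<Sum>u\<in>V. \<bar>y u\<bar>)\<^sup>2 \<le> (\<Sum>u\<in>V. \<bar>y u\<bar>\<^sup>2) * ?n" by (rule sum_squared_le_sum_of_squares)
    also have "(\<Sum>u\<in>V. \<bar>y u\<bar>\<^sup>2) = ip V y y" by (simp add: ip_def power2_eq_square)
    also have "ip V y y * ?n \<le> (6 * \<sigma>\<^sup>2 * ?n) * ?n" by (intro mult_right_mono y) simp
    also have "\<dots> = 6 * (\<sigma> * ?n)\<^sup>2" by (simp add: power2_eq_square algebra_simps)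
    also have "\<dots> \<le> 25 / 4 * (\<sigma> * ?n)\<^sup>2" by (intro mult_right_mono) auto
    also have "\<dots> = (5 / 2 * \<sigma> * ?n)\<^sup>2" by (simp add: power2_eq_square)
    finally show "(\<Sum>u\<in>V. \<bar>y u\<bar>)\<^sup>2 \<le> (5 / 2 * \<sigma> * ?n)\<^sup>2" .
  qed (use s in simp)
  then have "c * (\<Sum>u\<in>V. \<bar>y u\<bar>) \<le> c * (5 / 2 * \<sigma> * ?n)" using c0 by (rule mult_left_mono)
  also have "\<dots> = 5 / 2 * \<sigma> * (c * ?n)" by simp
  also have "\<dots> \<le> 5 / 2 * \<sigma> * 2" using s c by (intro mult_left_mono) auto
  finally show ?thesis by simp
qed

text \<open>Let \<open>a\<close> be the degree of \<open>v\<close> divided by \<open>\<mu>\<close>.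
  The normalised numbers of longer walks from \<open>v\<close> exceed \<open>a\<close> by a multiple
  of \<open>\<sigma>\<close> at most, so the paths through \<open>v\<close> number at most about
  \<open>\<mu>^4 * (2 * a + 3 * a^2)\<close>. This comes near \<open>5 * \<mu>^4\<close> only if
  \<open>a\<close> is not much below 1.\<close>

lemma min_degree_of_many_paths:
  fixes V :: "'a set" and \<sigma> :: real
  assumes G: "graph_on V A" and cl: "cliques_le V A r" and r: "r \<ge> 2" and n: "card V > 0"
    and s: "0 < \<sigma>" "\<sigma> \<le> 1 / 5"
    and \<mu>: "\<mu> = (1 - 1 / real r) * card V"
    and many: "real (card (paths5 A)) \<ge> (1 - \<sigma> ^ 4) * (\<mu> ^ 4 * card V)"
    and v: "v \<in> V" and thr: "real (card (through A v)) \<ge> (5 - 6 * \<sigma>\<^sup>2) * \<mu> ^ 4"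
  shows "real (card {u \<in> V. A v u}) \<ge> (1 - 11 * \<sigma>) * \<mu>"
proof -
  define K where "K = (\<lambda>u v. of_bool (A u v) :: real)"
  define k where "k = (\<lambda>u v. K u v / \<mu>)"
  let ?n = "real (card V)"
  have fin: "finite V" using G by (simp add: graph_on_def)
  have symK: "K u v = K v u" for u v using G by (auto simp: graph_on_def K_def)
  have sym: "k u v = k v u" for u v using symK by (simp add: k_def)
  have \<rho>: "1 - 1 / real r \<ge> 1 / 2" using r by (simp add: field_simps)
  have m0: "\<mu> > 0" unfolding \<mu> using \<rho> n by (intro mult_pos_pos) auto
  have nn: "k u v \<ge> 0" for u v using m0 by (simp add: k_def K_def)
  have kopK: "kernel_op V K y = (\<lambda>u. \<mu> * kernel_op V k y u)" for y
    using m0 by (auto simp: kernel_op_def k_def sum_distrib_left)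
  have kernel_op_scale: "kernel_op V k (\<lambda>u. c * y u) = (\<lambda>u. c * kernel_op V k y u)" for c y
    by (auto simp: kernel_op_def sum_distrib_left algebra_simps)
  have ms: "ip V y (kernel_op V k y) \<le> (\<Sum>v\<in>V. y v)\<^sup>2 / ?n" if y: "\<And>v. y v \<ge> 0" for y
  proof -
    have "\<mu> * ip V y (kernel_op V k y) = ip V y (kernel_op V K y)"
      by (simp add: kopK ip_def sum_distrib_left algebra_simps)
    also have "\<dots> \<le> (1 - 1 / real r) * (\<Sum>v\<in>V. y v)\<^sup>2"
      unfolding K_def by (rule motzkin_straus[OF G cl]) (use r y in auto)
    also have "\<dots> = \<mu> * ((\<Sum>v\<in>V. y v)\<^sup>2 / ?n)" using n by (simp add: \<mu>)
    finally show ?thesis using m0 by (simp only: mult_le_cancel_left_pos)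
  qed
  note contr = kernel_op_contraction[OF fin sym nn ms]
  define a where "a = kernel_op V k (\<lambda>_. 1)"
  define b where "b = kernel_op V k a"
  define c where "c = kernel_op V k b"
  define e where "e = kernel_op V k c"
  have w1: "kernel_op V K (\<lambda>_. 1) = (\<lambda>u. \<mu> * a u)" by (simp add: kopK a_def)
  have w2: "kernel_op V K (\<lambda>u. \<mu> * a u) = (\<lambda>u. \<mu>\<^sup>2 * b u)"
    by (simp add: kopK kernel_op_scale b_def power2_eq_square mult.assoc)
  have w3: "kernel_op V K (\<lambda>u. \<mu>\<^sup>2 * b u) = (\<lambda>u. \<mu> ^ 3 * c u)"
    by (simp add: kopK kernel_op_scale c_def power2_eq_square power3_eq_cube mult.assoc)
  have w4: "kernel_op V K (\<lambda>u. \<mu> ^ 3 * c u) = (\<lambda>u. \<mu> ^ 4 * e u)"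
    by (simp add: kopK kernel_op_scale e_def power3_eq_cube power4_eq_xxxx mult.assoc)
  have "real (card (paths5 A)) \<le> ip V (\<lambda>u. \<mu>\<^sup>2 * b u) (\<lambda>u. \<mu>\<^sup>2 * b u)"
    using card_paths5_le_walks[OF G K_def] by (simp only: w1 w2)
  also have "\<dots> = \<mu> ^ 4 * ip V b b"
    by (simp add: ip_def sum_distrib_left power2_eq_square power4_eq_xxxx algebra_simps)
  finally have "\<mu> ^ 4 * ((1 - \<sigma> ^ 4) * ?n) \<le> \<mu> ^ 4 * ip V b b"
    using many by (simp add: algebra_simps)
  then have big: "(1 - (\<sigma>\<^sup>2)\<^sup>2) * ?n \<le> ip V b b"
    using m0 by simp
  have s2: "0 < \<sigma>\<^sup>2" "\<sigma>\<^sup>2 \<le> 1" using s by (auto simp: power_le_one)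
  note fix1 = kernel_op_almost_fixes_one[OF fin n sym nn ms s2 a_def b_def big]
  have "ip V (\<lambda>v. 1 - b v) (\<lambda>v. 1 - b v) \<le> (\<sigma>\<^sup>2)\<^sup>2 * ?n" by (rule fix1(2))
  also have "\<dots> \<le> 6 * \<sigma>\<^sup>2 * ?n"
    using s2 mult_right_mono[of "\<sigma>\<^sup>2" 1 "\<sigma>\<^sup>2"] by (intro mult_right_mono) (auto simp: power2_eq_square)
  finally have b1: "ip V (\<lambda>v. 1 - b v) (\<lambda>v. 1 - b v) \<le> 6 * \<sigma>\<^sup>2 * ?n" .
  have ac: "ip V (\<lambda>v. a v - c v) (\<lambda>v. a v - c v) \<le> 6 * \<sigma>\<^sup>2 * ?n"
    using contr[of "\<lambda>v. 1 - b v"] b1 by (simp add: kernel_op_diff a_def[symmetric] c_def[symmetric])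
  have k1: "\<bar>k u v\<bar> \<le> 1 / \<mu>" for u v using m0 by (simp add: k_def K_def)
  have k2: "1 / \<mu> * ?n \<le> 2"
  proof -
    have "1 / 2 * ?n \<le> \<mu>" unfolding \<mu> using \<rho> by (rule mult_right_mono) simp
    then show ?thesis using m0 by (simp add: divide_le_eq)
  qed
  \<comment> \<open>The differences \<open>a - b\<close>, \<open>a - c\<close> and
    \<open>b - e\<close> are the images of \<open>1 - a\<close>, \<open>1 - b\<close> and
    \<open>a - c\<close>, all of small norm. The bound on \<open>e\<close> passes through
    \<open>b\<close>, hence the doubled error.\<close>
  note pw = kernel_op_pointwise[where k = k, OF k1 k2]
  have "\<bar>a v - b v\<bar> \<le> 5 * \<sigma>"
    using pw[OF fix1(1), where v = v] s by (simp add: kernel_op_diff a_def[symmetric] b_def[symmetric])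
  moreover have "\<bar>a v - c v\<bar> \<le> 5 * \<sigma>"
    using pw[OF b1, where v = v] s by (simp add: kernel_op_diff a_def[symmetric] c_def[symmetric])
  moreover have "\<bar>b v - e v\<bar> \<le> 5 * \<sigma>"
    using pw[OF ac, where v = v] s by (simp add: kernel_op_diff b_def[symmetric] e_def[symmetric])
  ultimately have bnd: "b v \<le> a v + 5 * \<sigma>" "c v \<le> a v + 5 * \<sigma>" "e v \<le> a v + 10 * \<sigma>" by linarith+
  have a0: "a v \<ge> 0" "b v \<ge> 0"
    unfolding a_def b_def kernel_op_def using nn by (auto intro!: sum_nonneg mult_nonneg_nonneg)
  have "real (card (through A v)) \<le> 2 * (\<mu> ^ 4 * e v) + 2 * (\<mu> * a v) * (\<mu> ^ 3 * c v) + (\<mu>\<^sup>2 * b v)\<^sup>2"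
    using card_through_le_walks[OF G K_def v w1[symmetric] w2[symmetric] w3[symmetric] w4[symmetric]] .
  also have "\<dots> = \<mu> ^ 4 * (2 * e v + 2 * a v * c v + (b v)\<^sup>2)"
    by (simp add: power2_eq_square power3_eq_cube power4_eq_xxxx algebra_simps)
  finally have "\<mu> ^ 4 * (5 - 6 * \<sigma>\<^sup>2) \<le> \<mu> ^ 4 * (2 * e v + 2 * a v * c v + (b v)\<^sup>2)"
    using thr by (simp add: mult.commute)
  then have key: "5 - 6 * \<sigma>\<^sup>2 \<le> 2 * e v + 2 * a v * c v + (b v)\<^sup>2"
    using m0 by simp
  \<comment> \<open>For \<open>a v \<le> 1\<close> squares are replaced by first powers and
    \<open>\<sigma>^2\<close> by \<open>\<sigma> / 5\<close>. Then \<open>key\<close> becomes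
    linear: \<open>5 \<le> 5 * a v + 47 * \<sigma>\<close>, with room to spare.\<close>
  have "a v \<ge> 1 - 11 * \<sigma>"
  proof (cases "a v \<le> 1")
    case True
    have "2 * a v * c v \<le> 2 * a v * (a v + 5 * \<sigma>)" using bnd a0 by (intro mult_left_mono) auto
    moreover have "(b v)\<^sup>2 \<le> (a v + 5 * \<sigma>)\<^sup>2" using bnd a0 by (intro power_mono) auto
    moreover have "a v * a v \<le> a v" "a v * \<sigma> \<le> \<sigma>" "\<sigma> * \<sigma> \<le> \<sigma> / 5"
      using True a0 s mult_right_mono[of "a v" 1 "a v"] mult_right_mono[of "a v" 1 \<sigma>]
        mult_right_mono[of \<sigma> "1 / 5" \<sigma>] by auto
    moreover have "2 * a v * (a v + 5 * \<sigma>) = 2 * (a v * a v) + 10 * (a v * \<sigma>)"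
      "(a v + 5 * \<sigma>)\<^sup>2 = a v * a v + 10 * (a v * \<sigma>) + 25 * (\<sigma> * \<sigma>)" "\<sigma>\<^sup>2 = \<sigma> * \<sigma>"
      by (simp_all add: power2_eq_square algebra_simps)
    ultimately show ?thesis using key bnd(3) s by linarith
  next
    case False
    then show ?thesis using s by simp
  qed
  then have "(1 - 11 * \<sigma>) * \<mu> \<le> \<mu> * a v" using m0 by simp
  also have "\<mu> * a v = kernel_op V K (\<lambda>_. 1) v" by (simp add: w1)
  also have "\<dots> = real (card {u \<in> V. A v u})"
    using fin by (simp add: kernel_op_def K_def Int_def)
  finally show ?thesis .
qed

section \<open>Replacing a vertex by a clone of another\<close>

text \<open>The edges are pulled back along the map that sends \<open>u\<close> to \<open>v\<close>.
  In a loopless graph this makes \<open>u\<close> a twin of \<open>v\<close> that is not adjacent to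
  it.\<close>

definition clone_adj :: "('a \<Rightarrow> 'a \<Rightarrow> bool) \<Rightarrow> 'a \<Rightarrow> 'a \<Rightarrow> 'a \<Rightarrow> 'a \<Rightarrow> bool" where
  "clone_adj A u v x y \<longleftrightarrow> x \<noteq> y \<and> A (if x = u then v else x) (if y = u then v else y)"

lemma graph_on_clone:
  assumes "graph_on V A" "u \<in> V" "v \<in> V"
  shows "graph_on V (clone_adj A u v)"
  using assms unfolding graph_on_def clone_adj_def by (auto split: if_splits)

text \<open>The map defining the clone carries cliques to cliques, and it is injective on them
  because identified vertices would need a loop at \<open>v\<close>.\<close>

lemma cliques_le_clone:
  assumes G: "graph_on V A" and cl: "cliques_le V A r" and uv: "u \<in> V" "v \<in> V" "u \<noteq> v"
  shows "cliques_le V (clone_adj A u v) r"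
  unfolding cliques_le_def
proof (intro allI impI)
  fix X assume X: "X \<subseteq> V" "\<forall>x\<in>X. \<forall>y\<in>X. x \<noteq> y \<longrightarrow> clone_adj A u v x y"
  let ?f = "\<lambda>x. if x = u then v else x"
  have irr: "\<not> A x x" for x using G by (auto simp: graph_on_def)
  have adj: "A (?f x) (?f y)" if "x \<in> X" "y \<in> X" "x \<noteq> y" for x y
    using X(2) that unfolding clone_adj_def by blast
  have inj: "inj_on ?f X"
  proof (rule inj_onI, rule ccontr)
    fix x y assume xy: "x \<in> X" "y \<in> X" "?f x = ?f y" "x \<noteq> y"
    then show False using adj[of x y] irr[of "?f y"] by simp
  qed
  have "?f ` X \<subseteq> V" using X(1) uv by auto
  moreover have "\<forall>x\<in>?f ` X. \<forall>y\<in>?f ` X. x \<noteq> y \<longrightarrow> A x y"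
  proof (intro ballI impI)
    fix p q assume "p \<in> ?f ` X" "q \<in> ?f ` X" "p \<noteq> q"
    then obtain x y where "x \<in> X" "y \<in> X" "p = ?f x" "q = ?f y" "x \<noteq> y" by blast
    with adj[of x y] show "A p q" by simp
  qed
  ultimately have "card (?f ` X) \<le> r" using cl unfolding cliques_le_def by blast
  then show "card X \<le> r" using card_image[OF inj] by metis
qed

text \<open>There are twenty ordered pairs of positions. The two marked entries have total weight
  one each, and the other three range freely over \<open>V\<close>.\<close>

lemma sum_two_marked:
  fixes f g :: "'a \<Rightarrow> real"
  assumes "finite V" and fg: "(\<Sum>x\<in>V. f x) = 1" "(\<Sum>x\<in>V. g x) = 1"
  shows "(\<Sum>a\<in>V. \<Sum>b\<in>V. \<Sum>c\<in>V. \<Sum>d\<in>V. \<Sum>e\<in>V.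
      f a * g b + f a * g c + f a * g d + f a * g e
      + f b * g a + f b * g c + f b * g d + f b * g e
      + f c * g a + f c * g b + f c * g d + f c * g e
      + f d * g a + f d * g b + f d * g c + f d * g e
      + f e * g a + f e * g b + f e * g c + f e * g d) = 20 * real (card V) ^ 3"
  by (simp add: sum.distrib sum_distrib_left[symmetric] sum_distrib_right[symmetric] fg power3_eq_cube)

lemma card_through_inter:
  assumes G: "graph_on V A" and uv: "u \<in> V" "v \<in> V" "u \<noteq> v"
  shows "real (card (through A u \<inter> through A v)) \<le> 20 * real (card V) ^ 3"
proof -
  have fin: "finite V" using G by (simp add: graph_on_def)
  let ?S = "\<lambda>f. \<Sum>a\<in>V. \<Sum>b\<in>V. \<Sum>c\<in>V. \<Sum>d\<in>V. \<Sum>e\<in>V. f a b c d e :: real"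
  let ?u = "\<lambda>x. of_bool (x = u) :: real" and ?v = "\<lambda>x. of_bool (x = v) :: real"
  let ?n = "real (card V)"
  let ?P = "\<lambda>a b c d e. (a, b, c, d, e) \<in> paths5 A \<and> u \<in> {a, b, c, d, e} \<and> v \<in> {a, b, c, d, e}"
  have "through A u \<inter> through A v = {(a, b, c, d, e). ?P a b c d e}"
    by (simp add: through_def split_beta set_eq_iff conj_ac)
  then have "real (card (through A u \<inter> through A v)) = ?S (\<lambda>a b c d e. of_bool (?P a b c d e))"
    by (simp only:) (rule card_5tuples[OF fin], use paths5_subset[OF G] in force)
  also have "\<dots> \<le> ?S (\<lambda>a b c d e. ?u a * ?v b + ?u a * ?v c + ?u a * ?v d + ?u a * ?v e
      + ?u b * ?v a + ?u b * ?v c + ?u b * ?v d + ?u b * ?v e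
      + ?u c * ?v a + ?u c * ?v b + ?u c * ?v d + ?u c * ?v e
      + ?u d * ?v a + ?u d * ?v b + ?u d * ?v c + ?u d * ?v e
      + ?u e * ?v a + ?u e * ?v b + ?u e * ?v c + ?u e * ?v d)"
  proof (intro sum_mono)
    fix a b c d e
    show "of_bool (?P a b c d e) \<le> ?u a * ?v b + ?u a * ?v c + ?u a * ?v d + ?u a * ?v e
      + ?u b * ?v a + ?u b * ?v c + ?u b * ?v d + ?u b * ?v e
      + ?u c * ?v a + ?u c * ?v b + ?u c * ?v d + ?u c * ?v e
      + ?u d * ?v a + ?u d * ?v b + ?u d * ?v c + ?u d * ?v e
      + ?u e * ?v a + ?u e * ?v b + ?u e * ?v c + ?u e * ?v d"
    proof (cases "?P a b c d e")
      case True
      then have "u \<in> {a, b, c, d, e}" "v \<in> {a, b, c, d, e}" by blast+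
      with uv(3) show ?thesis
        by (elim insertE emptyE) simp_all
    next
      case False
      then have "of_bool (?P a b c d e) = (0 :: real)" by (simp only: of_bool_eq(1))
      then show ?thesis by (simp only:) (intro add_nonneg_nonneg mult_nonneg_nonneg, simp_all)
    qed
  qed
  also have "\<dots> = 20 * ?n ^ 3"
    by (intro sum_two_marked fin) (use fin uv in \<open>simp_all add: Int_singleton\<close>)
  finally show ?thesis .
qed

text \<open>Paths avoiding \<open>u\<close> survive, and each path through \<open>v\<close> but not
  \<open>u\<close> yields a new one with \<open>u\<close> in place of \<open>v\<close>. Only the
  paths through both vertices spoil the balance of gain and loss.\<close>

lemma card_paths5_clone:
  assumes G: "graph_on V A" and uv: "u \<in> V" "v \<in> V" "u \<noteq> v"
  shows "real (card (paths5 A)) + card (through A v) \<le>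
     card (paths5 (clone_adj A u v)) + card (through A u) + 20 * real (card V) ^ 3"
proof -
  let ?f = "\<lambda>x. if x = v then u else x"
  let ?F = "\<lambda>(a, b, c, d, e). (?f a, ?f b, ?f c, ?f d, ?f e)"
  define P where "P = paths5 A"
  define U where "U = through A u"
  define W where "W = through A v"
  have finP: "finite P" using finite_paths5[OF G] by (simp add: P_def)
  have sub: "U \<subseteq> P" "W \<subseteq> P" by (auto simp: U_def W_def P_def through_def)
  have finU: "finite U" "finite W" using sub finP finite_subset by auto
  have inj: "inj_on ?F (W - U)"
  proof (rule inj_onI)
    fix s t assume st: "s \<in> W - U" "t \<in> W - U" "?F s = ?F t"
    obtain a b c d e where s: "s = (a, b, c, d, e)" by (cases s)
    obtain a' b' c' d' e' where t: "t = (a', b', c', d', e')" by (cases t)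
    have "u \<notin> {a, b, c, d, e}" "u \<notin> {a', b', c', d', e'}"
      using st sub by (auto simp: s t U_def W_def P_def through_def)
    then show "s = t" using st(3) by (auto simp: s t split: if_splits)
  qed
  have img: "?F ` (W - U) \<subseteq> paths5 (clone_adj A u v) - (P - U)"
  proof
    fix t assume "t \<in> ?F ` (W - U)"
    then obtain a b c d e where t: "(a, b, c, d, e) \<in> W - U" "t = ?F (a, b, c, d, e)" by auto
    have p: "(a, b, c, d, e) \<in> paths5 A" "v \<in> {a, b, c, d, e}" "u \<notin> {a, b, c, d, e}"
      using t(1) by (auto simp: U_def W_def P_def through_def)
    have "u \<in> {?f a, ?f b, ?f c, ?f d, ?f e}" using p(2) by auto
    then have "t \<notin> P - U" using t(2) by (auto simp: U_def P_def through_def)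
    moreover have "t \<in> paths5 (clone_adj A u v)"
    proof -
      have g: "(if ?f x = u then v else ?f x) = x" if "x \<noteq> u" for x using that by simp
      show ?thesis using p(1,3) unfolding t(2) paths5_def clone_adj_def
        by (auto simp: g)
    qed
    ultimately show "t \<in> paths5 (clone_adj A u v) - (P - U)" by blast
  qed
  have rest: "P - U \<subseteq> paths5 (clone_adj A u v)"
    by (auto simp: P_def U_def through_def paths5_def clone_adj_def)
  have fin': "finite (paths5 (clone_adj A u v))"
    using finite_paths5[OF graph_on_clone[OF G uv(1,2)]] .
  have "card (P - U) + card (W - U) = card (P - U) + card (?F ` (W - U))"
    using inj by (simp add: card_image)
  also have "\<dots> = card ((P - U) \<union> ?F ` (W - U))"
    using img finP finU by (subst card_Un_disjoint) auto
  also have "\<dots> \<le> card (paths5 (clone_adj A u v))"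
    using img rest fin' by (intro card_mono) auto
  finally have 1: "card (P - U) + card (W - U) \<le> card (paths5 (clone_adj A u v))" .
  have 2: "card P = card (P - U) + card U"
    using sub finU finP by (simp add: card_Diff_subset card_mono)
  have 3: "card W = card (W - U) + card (U \<inter> W)"
    using finU card_mono[of W "W \<inter> U"] by (simp add: card_Diff_subset_Int Int_commute)
  show ?thesis
    using 1 2 3 card_through_inter[OF G uv] unfolding P_def U_def W_def by linarith
qed

text \<open>Turning \<open>u\<close> into a clone of any \<open>v\<close> gains nothing in an
  extremal graph, so \<open>u\<close> lies on as many paths as \<open>v\<close>, up to the cubic
  error. Averaging over \<open>v\<close> brings in the factor 5, as each path has five
  vertices.\<close>

lemma through_of_extremal:
  assumes G: "graph_on V A" and cl: "cliques_le V A r" and n: "card V > 0"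
    and ext: "\<And>B. graph_on V B \<Longrightarrow> cliques_le V B r \<Longrightarrow> card (paths5 B) \<le> card (paths5 A)"
    and u: "u \<in> V"
  shows "real (card (through A u)) \<ge> 5 * real (card (paths5 A)) / card V - 20 * real (card V) ^ 3"
proof -
  have "real (card (through A v)) \<le> card (through A u) + 20 * real (card V) ^ 3" if "v \<in> V" for v
  proof (cases "u = v")
    case False
    then show ?thesis
      using card_paths5_clone[OF G u that False]
        ext[OF graph_on_clone[OF G u that] cliques_le_clone[OF G cl u that False]] by linarith
  qed simp
  then have "(\<Sum>v\<in>V. real (card (through A v))) \<le> card V * (card (through A u) + 20 * real (card V) ^ 3)"
    by (rule sum_bounded_above)
  moreover have "(\<Sum>v\<in>V. real (card (through A v))) = 5 * real (card (paths5 A))"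
    using sum_card_through[OF G] by (metis of_nat_sum of_nat_mult of_nat_numeral)
  ultimately show ?thesis using n by (simp add: field_simps)
qed

section \<open>Colouring graphs of large minimum degree\<close>

definition nbrs :: "'a set \<Rightarrow> ('a \<Rightarrow> 'a \<Rightarrow> bool) \<Rightarrow> 'a \<Rightarrow> 'a set" where
  "nbrs V A v = {u \<in> V. A v u}"

definition clique :: "('a \<Rightarrow> 'a \<Rightarrow> bool) \<Rightarrow> 'a set \<Rightarrow> bool" where
  "clique A X \<longleftrightarrow> (\<forall>x\<in>X. \<forall>y\<in>X. x \<noteq> y \<longrightarrow> A x y)"

lemma cliques_leD: "cliques_le V A r \<Longrightarrow> X \<subseteq> V \<Longrightarrow> clique A X \<Longrightarrow> card X \<le> r"
  by (auto simp: cliques_le_def clique_def)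

lemma clique_insert:
  assumes "graph_on V A" "clique A X" "\<forall>x\<in>X. A x y"
  shows "clique A (insert y X)" "y \<notin> X"
proof -
  have sym: "A u v \<Longrightarrow> A v u" and irr: "\<not> A u u" for u v
    using assms(1) unfolding graph_on_def by blast+
  show "y \<notin> X" using assms(3) irr by blast
  show "clique A (insert y X)" using assms(2,3) sym unfolding clique_def by blast
qed

text \<open>The vertices are picked one from each \<open>S q\<close>. Every vertex present excludes
  at most \<open>\<delta>\<close> candidates, and even at the last choice only
  \<open>card X0 + card T - 1\<close> vertices are present.\<close>

lemma greedy_clique:
  fixes \<delta> :: real
  assumes G: "graph_on V A" and fT: "finite T" and X0: "X0 \<subseteq> V" "clique A X0"
    and S: "\<And>q. q \<in> T \<Longrightarrow> S q \<subseteq> V"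
    and dX: "\<And>q v. q \<in> T \<Longrightarrow> v \<in> X0 \<Longrightarrow> card (S q - nbrs V A v) \<le> \<delta>"
    and dS: "\<And>p q v. p \<in> T \<Longrightarrow> q \<in> T \<Longrightarrow> p \<noteq> q \<Longrightarrow> v \<in> S p \<Longrightarrow> card (S q - nbrs V A v) \<le> \<delta>"
    and big: "\<And>q. q \<in> T \<Longrightarrow> card (S q) > (real (card X0 + card T) - 1) * \<delta>" and d0: "\<delta> \<ge> 0"
  shows "\<exists>X\<subseteq>V. clique A X \<and> card X = card X0 + card T"
proof -
  have fin: "finite V" using G by (simp add: graph_on_def)
  \<comment> \<open>The origin of the vertices is kept in the induction, since \<open>dS\<close> is
    only available for vertices from a set other than \<open>S q\<close>.\<close>
  have "\<exists>X\<subseteq>X0 \<union> (\<Union>q\<in>T'. S q). clique A X \<and> card X = card X0 + card T'" if "T' \<subseteq> T" for T'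
    using finite_subset[OF that fT] that
  proof (induction T' rule: finite_induct)
    case empty
    then show ?case using X0 by auto
  next
    case (insert q T')
    then obtain X where X: "X \<subseteq> X0 \<union> (\<Union>q\<in>T'. S q)" "clique A X" "card X = card X0 + card T'" by auto
    have q: "q \<in> T" "T' \<subseteq> T" using insert.prems by auto
    have XV: "X \<subseteq> V" using X(1) X0 S q(2) by blast
    have fX: "finite X" using XV fin finite_subset by blast
    have d: "card (S q - nbrs V A v) \<le> \<delta>" if v: "v \<in> X" for v
    proof (cases "v \<in> X0")
      case False
      then obtain p where "p \<in> T'" "v \<in> S p" using X(1) v by blast
      then show ?thesis using dS[of p q v] q insert.hyps by blast
    qed (use dX q in blast)
    have "real (card (\<Union>v\<in>X. S q - nbrs V A v)) \<le> real (\<Sum>v\<in>X. card (S q - nbrs V A v))"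
      using card_UN_le[OF fX] by (simp only: of_nat_le_iff)
    also have "\<dots> \<le> real (card X) * \<delta>"
      unfolding of_nat_sum using d by (intro sum_bounded_above) auto
    also have "\<dots> \<le> (real (card X0 + card T) - 1) * \<delta>"
    proof (rule mult_right_mono[OF _ d0])
      have "card (insert q T') \<le> card T" using insert.prems fT by (rule card_mono[rotated])
      then show "real (card X) \<le> real (card X0 + card T) - 1" using X(3) insert.hyps by simp
    qed
    also have "\<dots> < card (S q)" using big[OF q(1)] .
    finally have "card (\<Union>v\<in>X. S q - nbrs V A v) < card (S q)" by simp
    moreover have "finite (\<Union>v\<in>X. S q - nbrs V A v)"
      using fX S[OF q(1)] fin finite_subset by blast
    ultimately obtain y where y: "y \<in> S q" "y \<notin> (\<Union>v\<in>X. S q - nbrs V A v)"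
      using card_mono[of "\<Union>v\<in>X. S q - nbrs V A v" "S q"] by (meson leD subsetI)
    then have "\<forall>v\<in>X. A v y" unfolding nbrs_def by blast
    note c = clique_insert[OF G X(2) this]
    show ?case
    proof (intro exI[of _ "insert y X"] conjI)
      show "insert y X \<subseteq> X0 \<union> (\<Union>q\<in>insert q T'. S q)" using X(1) y(1) by blast
      show "card (insert y X) = card X0 + card (insert q T')"
        using c(2) fX X(3) insert.hyps by simp
    qed (rule c(1))
  qed
  from this[OF order_refl] obtain X where X: "X \<subseteq> X0 \<union> (\<Union>q\<in>T. S q)" "clique A X" "card X = card X0 + card T"
    by blast
  have "X \<subseteq> V" using X(1) X0 S by blast
  then show ?thesis using X by blast
qed

text \<open>A weak form of the Andrasfai--Erdos--Sos theorem. Around an \<open>r\<close>-clique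
  \<open>Q\<close> the sets \<open>W q\<close> of common neighbours of \<open>Q - {q}\<close> are
  disjoint, independent and of size nearly \<open>n / r\<close>. Each vertex has no neighbour in
  some \<open>W q\<close>, and this \<open>q\<close> serves as its colour; any failure lets the
  greedy lemma build \<open>r + 1\<close> pairwise adjacent vertices.\<close>

lemma colourable_of_min_degree:
  assumes G: "graph_on V A" and cl: "cliques_le V A r" and r: "r \<ge> 2" and n: "card V > 0"
    and e: "\<epsilon> = 1 / (4 * real r ^ 3)"
    and deg: "\<And>v. v \<in> V \<Longrightarrow> real (card (nbrs V A v)) \<ge> (1 - 1 / real r - \<epsilon>) * card V"
  shows "\<exists>col :: 'a \<Rightarrow> nat. (\<forall>v\<in>V. col v < r) \<and> (\<forall>u v. A u v \<longrightarrow> col u \<noteq> col v)"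
proof -
  let ?n = "real (card V)" and ?N = "nbrs V A"
  have fin: "finite V" using G by (simp add: graph_on_def)
  have sym: "A u v \<Longrightarrow> A v u" and irr: "\<not> A u u" and AV: "A u v \<Longrightarrow> u \<in> V \<and> v \<in> V" for u v
    using G unfolding graph_on_def by blast+
  \<comment> \<open>Every vertex has at most \<open>m\<close> non-neighbours, itself included. As
    \<open>W q\<close> has at least \<open>n - (r - 1) * m\<close> elements, \<open>\<delta>\<close>
    bounds how many non-neighbours are left outside \<open>W q\<close> for a vertex with no
    neighbour inside. The choice of \<open>\<epsilon>\<close> gives
    \<open>r * \<delta> = L / 4\<close>, where \<open>L\<close> below is the ideal class
    size.\<close>
  define m where "m = (1 / real r + \<epsilon>) * ?n"
  define \<delta> where "\<delta> = real r * \<epsilon> * ?n"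
  have e0: "\<epsilon> > 0" using r e by simp
  have r0: "real r \<ge> 2" using r by simp
  have re: "real r * (real r * \<epsilon>) = 1 / (4 * real r)" using r by (simp add: e power3_eq_cube)
  have re1: "real r * \<epsilon> \<le> 1 / (8 * real r)"
  proof -
    have "2 * (real r * \<epsilon>) \<le> real r * (real r * \<epsilon>)" using r0 e0 by (intro mult_right_mono) auto
    then show ?thesis by (simp add: re)
  qed
  have e1: "\<epsilon> \<le> 1 / (16 * real r)"
  proof -
    have "2 * \<epsilon> \<le> real r * \<epsilon>" using r0 e0 by (intro mult_right_mono) auto
    then show ?thesis using re1 by simp
  qed
  have d0: "\<delta> \<ge> 0" using e0 by (simp add: \<delta>_def)
  have m0: "m \<ge> 0" using e0 by (simp add: m_def)
  define L where "L = ?n / real r"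
  have L0: "L > 0" using n r by (simp add: L_def)
  have nL: "?n = real r * L" using r by (simp add: L_def)
  have en: "\<epsilon> * ?n \<le> L / 16" using mult_right_mono[OF e1, of ?n] by (simp add: L_def)
  have dL: "\<delta> \<le> L / 8" using mult_right_mono[OF re1, of ?n] by (simp add: L_def \<delta>_def)
  have rdL: "real r * \<delta> = L / 4"
  proof -
    have "real r * \<delta> = (real r * (real r * \<epsilon>)) * ?n" by (simp add: \<delta>_def)
    then show ?thesis unfolding re by (simp add: L_def)
  qed
  have mL: "m = L + \<epsilon> * ?n" by (simp add: m_def L_def algebra_simps)
  have cM: "card (V - ?N v) \<le> m" if "v \<in> V" for v
  proof -
    have s: "?N v \<subseteq> V" by (auto simp: nbrs_def)
    then have "real (card (V - ?N v)) = ?n - card (?N v)"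
      using fin by (simp add: card_Diff_subset finite_subset card_mono of_nat_diff)
    also have "\<dots> \<le> ?n - (1 - 1 / real r - \<epsilon>) * ?n" using deg[OF that] by simp
    also have "\<dots> = m" by (simp add: m_def algebra_simps)
    finally show ?thesis .
  qed
  have rm: "(real r - 1) * m \<le> ?n - L + \<delta> - \<epsilon> * ?n"
    by (simp add: mL nL \<delta>_def algebra_simps)
  have small: "(real r - 1) * m < ?n" using rm dL L0 mult_pos_pos[of \<epsilon> ?n] e0 n by linarith
  \<comment> \<open>Greedy choice from all of \<open>V\<close> with nothing given:
    \<open>r - 1\<close> vertices exclude fewer than \<open>n\<close> candidates.\<close>
  have "\<exists>X\<subseteq>V. clique A X \<and> card X = card ({} :: 'a set) + card {..<r}"
  proof (rule greedy_clique[OF G, where S = "\<lambda>_. V" and \<delta> = m])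
    show "(real (card ({} :: 'a set) + card {..<r}) - 1) * m < real (card V)" using small by simp
  qed (use cM m0 in \<open>auto simp: clique_def\<close>)
  then obtain Q where Q: "Q \<subseteq> V" "clique A Q" "card Q = r" by auto
  have finQ: "finite Q" using Q fin finite_subset by blast
  define W where "W = (\<lambda>q. {x \<in> V. \<forall>p\<in>Q - {q}. A x p})"
  have WV: "W q \<subseteq> V" for q by (auto simp: W_def)
  have nadj: "\<not> A x q" if "x \<in> W q" "q \<in> Q" for x q
  proof
    assume "A x q"
    then have "\<forall>p\<in>Q. A p x" using \<open>x \<in> W q\<close> sym by (auto simp: W_def)
    from clique_insert[OF G Q(2) this] have "clique A (insert x Q)" "x \<notin> Q" .
    then show False using cliques_leD[OF cl, of "insert x Q"] Q finQ that WV[of q] by auto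
  qed
  have disj: "W p \<inter> W q = {}" if "p \<in> Q" "q \<in> Q" "p \<noteq> q" for p q
    using nadj that by (auto simp: W_def)
  \<comment> \<open>Two adjacent vertices of \<open>W q\<close> could together replace
    \<open>q\<close> in \<open>Q\<close>.\<close>
  have indep: "\<not> A x y" if "x \<in> W q" "y \<in> W q" "q \<in> Q" for x y q
  proof
    assume xy: "A x y"
    have c0: "clique A (Q - {q})" using Q(2) by (auto simp: clique_def)
    have "\<forall>p\<in>Q - {q}. A p x" using \<open>x \<in> W q\<close> sym by (auto simp: W_def)
    note c1 = clique_insert[OF G c0 this]
    have "\<forall>p\<in>insert x (Q - {q}). A p y" using \<open>y \<in> W q\<close> sym xy by (auto simp: W_def)
    note c2 = clique_insert[OF G c1(1) this]
    have "card (insert y (insert x (Q - {q}))) = r + 1"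
      using c1(2) c2(2) finQ Q(3) that(3) r by simp
    then show False using cliques_leD[OF cl _ c2(1)] Q(1) that(1,2) WV by fastforce
  qed
  have cW: "card (W q) \<ge> L - \<delta> + \<epsilon> * ?n" if q: "q \<in> Q" for q
  proof -
    have "V - W q \<subseteq> (\<Union>p\<in>Q - {q}. V - ?N p)"
      using sym by (auto simp: W_def nbrs_def)
    then have "card (V - W q) \<le> card (\<Union>p\<in>Q - {q}. V - ?N p)"
      using fin finQ by (intro card_mono) auto
    also have "\<dots> \<le> (\<Sum>p\<in>Q - {q}. card (V - ?N p))" using finQ by (intro card_UN_le) auto
    finally have "real (card (V - W q)) \<le> (\<Sum>p\<in>Q - {q}. real (card (V - ?N p)))"
      by (metis of_nat_sum of_nat_le_iff)
    also have "\<dots> \<le> real (card (Q - {q})) * m"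
      using Q cM by (intro sum_bounded_above) auto
    also have "\<dots> = (real r - 1) * m" using q Q(3) finQ r by (simp add: of_nat_diff)
    finally have "real (card (V - W q)) \<le> ?n - L + \<delta> - \<epsilon> * ?n" using rm by linarith
    moreover have "card (V - W q) = card V - card (W q)" "card (W q) \<le> card V"
      using WV fin by (simp_all add: card_Diff_subset finite_subset[OF WV fin] card_mono)
    ultimately show ?thesis by (simp add: of_nat_diff)
  qed
  \<comment> \<open>The set \<open>W q\<close> already uses up nearly all the non-neighbours that
    the degree condition allows to \<open>x\<close>.\<close>
  have few: "card (V - ?N x - W q) \<le> \<delta>" if "x \<in> V" "q \<in> Q" "?N x \<inter> W q = {}" for x q
  proof -
    have s: "W q \<subseteq> V - ?N x" using WV that(3) by blast
    have "card (V - ?N x - W q) = card (V - ?N x) - card (W q)" "card (W q) \<le> card (V - ?N x)"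
      using s fin by (simp_all add: card_Diff_subset finite_subset[OF WV fin] card_mono)
    then show ?thesis using cM[OF that(1)] cW[OF that(2)] mL by (simp add: of_nat_diff)
  qed
  have fewW: "card (W p - ?N x) \<le> \<delta>" if "x \<in> V" "q \<in> Q" "p \<in> Q" "p \<noteq> q" "?N x \<inter> W q = {}" for x p q
  proof -
    have "W p - ?N x \<subseteq> V - ?N x - W q" using disj[of p q] that WV by blast
    then have "card (W p - ?N x) \<le> card (V - ?N x - W q)" using fin by (intro card_mono) auto
    then show ?thesis using few[OF that(1,2,5)] by linarith
  qed
  have NW: "?N v \<inter> W q = {}" if "v \<in> W q" "q \<in> Q" for v q
    using indep that by (auto simp: nbrs_def)
  have cX: "card {x, y} = 2" if "A x y" for x y
  proof -
    have "x \<noteq> y" using irr that by blast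
    then show ?thesis by simp
  qed
  have cl2: "clique A {x, y}" if "A x y" for x y using that sym by (auto simp: clique_def)
  \<comment> \<open>The cliques sought have \<open>r + 1\<close> vertices, so at most
    \<open>r\<close> of them restrict the choice of the next one.\<close>
  have size: "real (card {x, y} + card (Q - {q})) - 1 = real r" if "A x y" "q \<in> Q" for x y q
    using cX[OF that(1)] that(2) Q(3) finQ r by (simp add: of_nat_diff)
  have nocl: False if t: "A x y" "q \<in> Q" "\<exists>X\<subseteq>V. clique A X \<and> card X = card {x, y} + card (Q - {q})" for x y q
  proof -
    obtain X where X: "X \<subseteq> V" "clique A X" "card X = card {x, y} + card (Q - {q})" using t(3) by blast
    have "real (card X) = real r + 1" using size[OF t(1,2)] X(3) by linarith
    then show False using cliques_leD[OF cl X(1,2)] by linarith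
  qed
  \<comment> \<open>Let \<open>x\<close> miss most in \<open>W q\<close>. By disjointness it misses
    at most \<open>m / 2\<close> vertices of any other \<open>W p\<close>, so more than
    \<open>L / 4\<close> neighbours remain there. Starting with \<open>x\<close> and a neighbour
    \<open>v\<close> in \<open>W q\<close>, the greedy choice inside the neighbourhood of
    \<open>x\<close> succeeds.\<close>
  have ex: "\<exists>q\<in>Q. ?N x \<inter> W q = {}" if x: "x \<in> V" for x
  proof (rule ccontr)
    assume no: "\<not> (\<exists>q\<in>Q. ?N x \<inter> W q = {})"
    let ?c = "\<lambda>q. card (W q - ?N x)"
    have ne: "?c ` Q \<noteq> {}" using Q(3) r by auto
    have "Max (?c ` Q) \<in> ?c ` Q" using finQ ne by (intro Max_in) auto
    then obtain q where q: "q \<in> Q" "?c q = Max (?c ` Q)" by auto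
    have qmax: "?c p \<le> ?c q" if "p \<in> Q" for p using finQ that unfolding q(2) by (intro Max_ge) auto
    obtain v where v: "v \<in> ?N x" "v \<in> W q" using no q(1) by blast
    then have xv: "A x v" by (simp add: nbrs_def)
    have half: "real (card (W p \<inter> ?N x)) > real r * \<delta>" if p: "p \<in> Q - {q}" for p
    proof -
      have "?c p + ?c q = card ((W p - ?N x) \<union> (W q - ?N x))"
        using disj[of p q] p q(1) finite_subset[OF WV fin] by (subst card_Un_disjoint) auto
      also have "\<dots> \<le> card (V - ?N x)" using WV fin by (intro card_mono) auto
      finally have "2 * real (?c p) \<le> m" using qmax[of p] p cM[OF x] by simp
      moreover have "card (W p) = card (W p \<inter> ?N x) + ?c p"
        using finite_subset[OF WV fin] by (metis Int_Diff_Un Int_Diff_disjoint card_Un_disjoint finite_Diff finite_Int)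
      moreover have "L - \<delta> + \<epsilon> * ?n \<le> card (W p)" using cW[of p] p by simp
      moreover have "\<epsilon> * ?n > 0" using e0 n by simp
      ultimately show ?thesis using mL dL rdL L0 by linarith
    qed
    have "\<exists>X\<subseteq>V. clique A X \<and> card X = card {x, v} + card (Q - {q})"
    proof (rule greedy_clique[OF G, where S = "\<lambda>p. W p \<inter> ?N x" and \<delta> = \<delta>])
      show "real (card (W p \<inter> ?N x - ?N u)) \<le> \<delta>" if "p \<in> Q - {q}" "u \<in> {x, v}" for p u
      proof (cases "u = x")
        case True
        then have "W p \<inter> ?N x - ?N u = {}" by blast
        then show ?thesis using d0 by (metis card.empty of_nat_0)
      next
        case False
        then have u: "u = v" using that by simp
        have "card (W p \<inter> ?N x - ?N u) \<le> card (W p - ?N u)"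
          using finite_subset[OF WV fin] by (intro card_mono) auto
        then show ?thesis using fewW[of v q p] NW[OF v(2) q(1)] that(1) q(1) u v WV by fastforce
      qed
      show "real (card (W p \<inter> ?N x - ?N u)) \<le> \<delta>"
        if "p' \<in> Q - {q}" "p \<in> Q - {q}" "p' \<noteq> p" "u \<in> W p' \<inter> ?N x" for p p' u
      proof -
        have "card (W p \<inter> ?N x - ?N u) \<le> card (W p - ?N u)"
          using finite_subset[OF WV fin] by (intro card_mono) auto
        then show ?thesis using fewW[of u p' p] NW[of u p'] that WV by fastforce
      qed
      show "(real (card {x, v} + card (Q - {q})) - 1) * \<delta> < real (card (W p \<inter> ?N x))" if "p \<in> Q - {q}" for p
        using half[OF that] size[OF xv q(1)] by simp
    qed (use finQ WV x v(2) cl2[OF xv] d0 in auto)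
    then show False by (rule nocl[OF xv q(1)])
  qed
  \<comment> \<open>Both vertices miss few elements of each other \<open>W p\<close>, so an edge
    between them would extend by one vertex from every such set.\<close>
  have indep2: "\<not> A x y" if q: "q \<in> Q" and xy: "?N x \<inter> W q = {}" "?N y \<inter> W q = {}" for x y q
  proof
    assume Axy: "A x y"
    have xyV: "x \<in> V" "y \<in> V" using AV[OF Axy] by auto
    have "\<exists>X\<subseteq>V. clique A X \<and> card X = card {x, y} + card (Q - {q})"
    proof (rule greedy_clique[OF G, where S = W and \<delta> = \<delta>])
      show "real (card (W p - ?N u)) \<le> \<delta>" if "p \<in> Q - {q}" "u \<in> {x, y}" for p u
        using fewW[of u q p] that q xy xyV by auto
      show "real (card (W p - ?N u)) \<le> \<delta>"
        if "p' \<in> Q - {q}" "p \<in> Q - {q}" "p' \<noteq> p" "u \<in> W p'" for p p' u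
        using fewW[of u p' p] NW[of u p'] that WV by fastforce
      show "(real (card {x, y} + card (Q - {q})) - 1) * \<delta> < real (card (W p))" if "p \<in> Q - {q}" for p
      proof -
        have "real r * \<delta> < L - \<delta> + \<epsilon> * ?n" using rdL dL L0 e0 n mult_pos_pos[of \<epsilon> ?n] by linarith
        then show ?thesis using cW[of p] that size[OF Axy q] by simp
      qed
    qed (use finQ WV xyV cl2[OF Axy] d0 in auto)
    then show False by (rule nocl[OF Axy q])
  qed
  obtain h where h: "bij_betw h Q {..<r}"
    using ex_bij_betw_finite_nat[OF finQ] Q(3) by (metis atLeast0LessThan)
  define ch where "ch = (\<lambda>x. SOME q. q \<in> Q \<and> ?N x \<inter> W q = {})"
  have ch: "ch x \<in> Q" "?N x \<inter> W (ch x) = {}" if "x \<in> V" for x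
    using someI_ex[of "\<lambda>q. q \<in> Q \<and> ?N x \<inter> W q = {}"] ex[OF that] unfolding ch_def by blast+
  show ?thesis
  proof (intro exI[of _ "h \<circ> ch"] conjI ballI allI impI)
    fix v assume "v \<in> V"
    then show "(h \<circ> ch) v < r" using ch(1) h by (auto simp: bij_betw_def)
  next
    fix u v assume uv: "A u v"
    then have V: "u \<in> V" "v \<in> V" using AV by auto
    have "ch u \<noteq> ch v" using indep2[OF ch(1)[OF V(1)] ch(2)[OF V(1)]] ch(2)[OF V(2)] uv by metis
    then show "(h \<circ> ch) u \<noteq> (h \<circ> ch) v"
      using h ch(1)[OF V(1)] ch(1)[OF V(2)] by (auto simp: bij_betw_def inj_on_def)
  qed
qed

section \<open>Paths in complete multipartite graphs\<close>

text \<open>The list names the classes of the vertices already used. Only the occurrences of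
  \<open>x\<close> in it count, which is why it can be reversed, or filtered to a set of classes
  that contains \<open>x\<close>.\<close>

fun avail :: "(nat \<Rightarrow> nat) \<Rightarrow> nat \<Rightarrow> nat list \<Rightarrow> nat" where
  "avail m x [] = m x"
| "avail m x (y # ys) = avail m x ys - of_bool (x = y)"

declare avail.simps [simp del]

definition differ :: "nat \<Rightarrow> nat \<Rightarrow> nat" where
  "differ x y = of_bool (x \<noteq> y)"

text \<open>
  The number of paths whose successive vertices lie in the classes \<open>a, b, c, d, e\<close>, when \<open>m\<close> gives
  the class sizes. The subtractions in \<open>avail\<close> are truncated, which does no harm: if the true
  difference is negative, an earlier factor is zero.
\<close>

definition mp_term :: "(nat \<Rightarrow> nat) \<Rightarrow> nat \<Rightarrow> nat \<Rightarrow> nat \<Rightarrow> nat \<Rightarrow> nat \<Rightarrow> nat" where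
  "mp_term m a b c d e = differ a b * differ b c * differ c d * differ d e *
     (avail m a [] * avail m b [a] * avail m c [a, b] * avail m d [a, b, c] * avail m e [a, b, c, d])"

text \<open>
  For \<open>Z = {i, j}\<close> the term splits into a factor \<open>outer\<close> that is not affected by moving a
  vertex from class \<open>i\<close> to class \<open>j\<close>, and a factor \<open>inner\<close> that only depends on the sizes of these two
  classes. With \<open>fold2\<close> one sums over all ways of replacing entries \<open>i\<close> by \<open>j\<close>, which leaves
  an inequality between polynomials in the two sizes for each set of positions.
\<close>

definition outer :: "nat set \<Rightarrow> (nat \<Rightarrow> nat) \<Rightarrow> nat \<Rightarrow> nat \<Rightarrow> nat \<Rightarrow> nat \<Rightarrow> nat \<Rightarrow> nat" where
  "outer Z m a b c d e =
    (let w = (\<lambda>x ys. if x \<in> Z then 1 else avail m x (filter (\<lambda>y. y \<notin> Z) ys)); t = (\<lambda>x y. if x \<in> Z \<or> y \<in> Z then 1 else differ x y)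
     in t a b * t b c * t c d * t d e * (w a [] * w b [a] * w c [a, b] * w d [a, b, c] * w e [a, b, c, d]))"

definition inner :: "nat set \<Rightarrow> (nat \<Rightarrow> nat) \<Rightarrow> nat \<Rightarrow> nat \<Rightarrow> nat \<Rightarrow> nat \<Rightarrow> nat \<Rightarrow> nat" where
  "inner Z m a b c d e =
    (let w = (\<lambda>x ys. if x \<in> Z then avail m x (filter (\<lambda>y. y \<in> Z) ys) else 1); t = (\<lambda>x y. if x \<in> Z \<and> y \<in> Z then differ x y else 1)
     in t a b * t b c * t c d * t d e * (w a [] * w b [a] * w c [a, b] * w d [a, b, c] * w e [a, b, c, d]))"

lemma avail_rev:
  "avail m x [b, a] = avail m x [a, b]" "avail m x [c, b, a] = avail m x [a, b, c]"
  "avail m x [d, c, b, a] = avail m x [a, b, c, d]"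
  by (simp_all add: avail.simps)

lemma avail_split: "avail m x ys = (if x \<in> Z then avail m x (filter (\<lambda>y. y \<in> Z) ys) else 1)
   * (if x \<in> Z then 1 else avail m x (filter (\<lambda>y. y \<notin> Z) ys))"
  by (induction ys) (auto simp: avail.simps)

text \<open>If exactly one of the classes lies in \<open>Z\<close> they differ anyway, so both
  factors are 1. Hence the first factor does not see which element of \<open>Z\<close>
  occurs.\<close>

lemma differ_split: "differ x y = (if x \<in> Z \<or> y \<in> Z then 1 else differ x y) * (if x \<in> Z \<and> y \<in> Z then differ x y else 1)"
  by (auto simp: differ_def)

lemma mult_swap10: "(t1 * u1) * (t2 * u2) * (t3 * u3) * (t4 * u4) *
   ((v1 * w1) * (v2 * w2) * (v3 * w3) * (v4 * w4) * (v5 * w5)) =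
   (t1 * t2 * t3 * t4 * (w1 * w2 * w3 * w4 * w5)) * (u1 * u2 * u3 * u4 * (v1 * v2 * v3 * v4 * v5 :: nat))"
  by (simp only: ac_simps)

lemma mp_term_split: "mp_term m a b c d e = outer Z m a b c d e * inner Z m a b c d e"
  unfolding mp_term_def outer_def inner_def Let_def
  by (subst differ_split[of a b Z], subst differ_split[of b c Z], subst differ_split[of c d Z],
    subst differ_split[of d e Z],
    subst avail_split[of m a _ Z], subst avail_split[of m b _ Z], subst avail_split[of m c _ Z],
    subst avail_split[of m d _ Z], subst avail_split[of m e _ Z], rule mult_swap10)

section \<open>Moving one vertex between two classes\<close>

definition fold2 :: "nat \<Rightarrow> nat \<Rightarrow> (nat \<Rightarrow> nat) \<Rightarrow> nat \<Rightarrow> nat" where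
  "fold2 i j f c = f c + (if c = i then f j else 0)"

lemma fold2_same: "fold2 i j f i = f i + f j"
  by (simp add: fold2_def)

lemma fold2_other: "c \<noteq> i \<Longrightarrow> fold2 i j f c = f c"
  by (simp add: fold2_def)

lemma fold2_mult: "f j = f i \<Longrightarrow> fold2 i j (\<lambda>x. f x * g x) c = f c * fold2 i j g c"
  by (simp add: fold2_def algebra_simps)

lemma outer_swap:
  fixes i j :: nat
  shows
  "outer {i, j} m j b c d e = outer {i, j} m i b c d e"
  "outer {i, j} m a j c d e = outer {i, j} m a i c d e"
  "outer {i, j} m a b j d e = outer {i, j} m a b i d e"
  "outer {i, j} m a b c j e = outer {i, j} m a b c i e"
  "outer {i, j} m a b c d j = outer {i, j} m a b c d i"
  by (simp_all add: outer_def)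

lemma avail_upd: "x \<notin> {i, j} \<Longrightarrow> avail (m(i := p, j := q)) x ys = avail m x ys"
  by (induction ys) (auto simp: avail.simps)

lemma outer_upd: "outer {i, j} (m(i := p, j := q)) = outer {i, j} m"
proof -
  have "(if x \<in> {i, j} then 1 else avail (m(i := p, j := q)) x ys) = (if x \<in> {i, j} then 1 else avail m x ys)" for x ys
    using avail_upd[of x i j m p q ys] by simp
  then show ?thesis by (intro ext) (simp only: outer_def)
qed

lemma avail_other: "x \<noteq> y \<Longrightarrow> avail m x (y # ys) = avail m x ys"
  by (simp add: avail.simps)

lemma avail_same: "avail m x (x # ys) = avail m x ys - 1"
  by (simp add: avail.simps)

lemma differ: "differ x x = 0" "x \<noteq> y \<Longrightarrow> differ x y = 1"
  by (simp_all add: differ_def)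

text \<open>The move keeps the sum of the two sizes and does not lower their product. An isolated
  position contributes through the sum alone, while adjacent positions must alternate between the
  two classes: a single adjacent pair, for instance, gives twice the product.\<close>

lemma inner_move:
  assumes ij: "i \<noteq> j" and p: "m i = Suc (m j + k)"
    and m': "m' = m(i := m j + k, j := Suc (m j))"
    and ne: "a \<noteq> j" "b \<noteq> j" "c \<noteq> j" "d \<noteq> j" "e \<noteq> j"
  shows "fold2 i j (\<lambda>a. fold2 i j (\<lambda>b. fold2 i j (\<lambda>c. fold2 i j (\<lambda>d. fold2 i j (\<lambda>e.
     inner {i, j} m a b c d e) e) d) c) b) a \<le> fold2 i j (\<lambda>a. fold2 i j (\<lambda>b. fold2 i j (\<lambda>c. fold2 i j (\<lambda>d. fold2 i j (\<lambda>e.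
     inner {i, j} m' a b c d e) e) d) c) b) a"
proof -
  obtain p' q q' p where q: "q = m j" "p = m i" "p' = m' i" "q' = m' j" by blast
  have sym: "x \<noteq> i \<Longrightarrow> i \<noteq> x" for x by blast
  have vals: "avail m i [] = p" "avail m j [] = q" "avail m' i [] = p'" "avail m' j [] = q'"
    using ij by (simp_all add: avail.simps q)
  have "p = q + k + 1" "p' = q + k" "q' = q + 1" using p m' ij by (simp_all add: q)
  \<comment> \<open>A path meets a class at most three times, so nonzero terms subtract at most 2.
    Writing the sizes as \<open>x\<close> plus a constant of at least 2, and splitting off the
    smaller values, makes truncated subtraction disappear.\<close>
  moreover have "q = 0 \<and> k = 0 \<or> q = 0 \<and> k = 1 \<or> (\<exists>k'. q = 0 \<and> k = k' + 2)
    \<or> q = 1 \<and> k = 0 \<or> (\<exists>k'. q = 1 \<and> k = k' + 1) \<or> (\<exists>t. q = t + 2)"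
    by presburger
  ultimately consider "p = 1" "q = 0" "p' = 0" "q' = 1" | "p = 2" "q = 0" "p' = 1" "q' = 1"
    | x where "p = x + 3" "q = 0" "p' = x + 2" "q' = 1" | "p = 2" "q = 1" "p' = 1" "q' = 2"
    | x where "p = x + 3" "q = 1" "p' = x + 2" "q' = 2" | x where "p = x + k + 3" "q = x + 2" "p' = x + k + 2" "q' = x + 3"
    by force
  note val_cases = this
  show ?thesis
    \<comment> \<open>These are the 32 sets of positions occupied by the two classes; an entry
      \<open>i\<close> stands for either class, and other entries do not matter for
      \<open>inner\<close>.\<close>
    by (cases "a = i"; cases "b = i"; cases "c = i"; cases "d = i"; cases "e = i";
      simp only: fold2_same fold2_other inner_def Let_def insert_iff empty_iff if_True if_False simp_thms
        ij ij[symmetric] ne ne[symmetric] sym filter.simps avail_other avail_same vals differ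
        mult_1_left mult_1_right mult_zero_left mult_zero_right add_0_left add_0_right order_refl;
      rule val_cases; simp; simp add: algebra_simps)
qed

lemma mp_term_move:
  assumes ij: "i \<noteq> j" and p: "m i = Suc (m j + k)"
    and ne: "a \<noteq> j" "b \<noteq> j" "c \<noteq> j" "d \<noteq> j" "e \<noteq> j"
  shows "fold2 i j (\<lambda>a. fold2 i j (\<lambda>b. fold2 i j (\<lambda>c. fold2 i j (\<lambda>d. fold2 i j (\<lambda>e.
     mp_term m a b c d e) e) d) c) b) a \<le> fold2 i j (\<lambda>a. fold2 i j (\<lambda>b. fold2 i j (\<lambda>c. fold2 i j (\<lambda>d. fold2 i j (\<lambda>e.
     mp_term (m(i := m j + k, j := Suc (m j))) a b c d e) e) d) c) b) a"
  unfolding mp_term_split[where Z = "{i, j}"] outer_upd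
  by (simp only: fold2_mult outer_swap) (rule mult_left_mono[OF inner_move[OF ij p refl ne] zero_le])

definition mp_paths :: "nat \<Rightarrow> (nat \<Rightarrow> nat) \<Rightarrow> nat" where
  "mp_paths r m = (\<Sum>a<r. \<Sum>b<r. \<Sum>c<r. \<Sum>d<r. \<Sum>e<r. mp_term m a b c d e)"

lemma fold2_sum: "fold2 i j (\<lambda>x. \<Sum>y\<in>Q. h x y) c = (\<Sum>y\<in>Q. fold2 i j (\<lambda>x. h x y) c)"
  by (simp add: fold2_def sum.distrib)

text \<open>The index \<open>i\<close> now represents both classes, so each of the five sums can
  skip \<open>j\<close>, and the move can be compared term by term.\<close>

lemma sum_fold2:
  assumes "i < r" "j < r" "i \<noteq> j"
  shows "(\<Sum>c<r. f c) = (\<Sum>c\<in>{..<r} - {j}. fold2 i j f c)"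
  using assms by (simp add: fold2_def sum.distrib sum.remove[of "{..<r}" j])

lemma mp_paths_move:
  assumes ij: "i < r" "j < r" "i \<noteq> j" and m: "m i > m j"
  shows "mp_paths r m \<le> mp_paths r (m(i := m i - 1, j := m j + 1))"
proof -
  obtain k where k: "m i = Suc (m j + k)" using m less_iff_Suc_add by blast
  then have *: "m(i := m i - 1, j := m j + 1) = m(i := m j + k, j := Suc (m j))" by simp
  show ?thesis
    unfolding mp_paths_def sum_fold2[OF ij] fold2_sum *
    by (intro sum_mono mp_term_move ij k) auto
qed

section \<open>Counting the paths of a complete multipartite graph by classes\<close>

lemma card_class_diff:
  assumes "finite V" "X \<subseteq> V"
  shows "card {x \<in> V - X. col x = c} = card {x \<in> V. col x = c} - card {x \<in> X. col x = c}"
proof -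
  have "{x \<in> V - X. col x = c} = {x \<in> V. col x = c} - {x \<in> X. col x = c}" using assms by auto
  then show ?thesis using assms finite_subset[of X V]
    by (simp only:) (rule card_Diff_subset, auto)
qed

lemma sum_by_class:
  fixes f :: "nat \<Rightarrow> nat"
  assumes fin: "finite V" and X: "X \<subseteq> V" and col: "\<And>v. v \<in> V \<Longrightarrow> col v < r"
  shows "(\<Sum>x\<in>V. of_bool (x \<notin> X) * f (col x)) =
    (\<Sum>c<r. (card {x \<in> V. col x = c} - card {x \<in> X. col x = c}) * f c)"
proof -
  have "(\<Sum>x\<in>V. of_bool (x \<notin> X) * f (col x)) = (\<Sum>x\<in>V - X. f (col x))"
    using fin by (intro sum.mono_neutral_cong_right) auto
  also have "\<dots> = (\<Sum>c<r. \<Sum>x\<in>{x \<in> V - X. col x = c}. f (col x))"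
    by (rule sum.group[symmetric]) (use fin col in auto)
  also have "\<dots> = (\<Sum>c<r. (card {x \<in> V. col x = c} - card {x \<in> X. col x = c}) * f c)"
    by (intro sum.cong refl) (simp add: card_class_diff[OF fin X, symmetric])
  finally show ?thesis .
qed

text \<open>The vertices are summed out from the last to the first. Once the earlier vertices are
  fixed and distinct, the number of choices in a class depends only on their colours.\<close>

lemma card_paths5_multipartite:
  assumes fin: "finite V" and col: "\<And>v. v \<in> V \<Longrightarrow> col v < r"
    and m: "m = (\<lambda>c. card {x \<in> V. col x = c})"
  shows "card (paths5 (\<lambda>x y. x \<in> V \<and> y \<in> V \<and> col x \<noteq> col y)) = mp_paths r m"
proof -
  define S where "S X f = (\<Sum>x\<in>V. of_bool (x \<notin> X) * f (col x))" for X and f :: "nat \<Rightarrow> nat"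
  have left: "m x - card {z \<in> set zs. col z = x} = avail m x (map col zs)" if "distinct zs" for x zs
    using that
  proof (induction zs)
    case (Cons z zs)
    have "{y \<in> set (z # zs). col y = x} = (if col z = x then insert z else id) {y \<in> set zs. col y = x}" by auto
    then show ?case using Cons by (auto simp: avail.simps)
  qed (simp add: avail.simps)
  have S: "S (set zs) f = (\<Sum>c<r. avail m c (map col zs) * f c)" if "distinct zs" "set zs \<subseteq> V" for zs f
    unfolding S_def using sum_by_class[OF fin that(2) col, where f = f] left[OF that(1)] by (simp add: m)
  \<comment> \<open>Here \<open>P\<close> collects the conditions on the earlier vertices
    \<open>zs\<close>. Distinctness is needed only under \<open>P\<close>, as both sides vanish
    otherwise.\<close>
  have step: "(\<Sum>x\<in>V. of_bool (P \<and> x \<notin> set zs \<and> col y \<noteq> col x) * f (col x)) = of_bool P * (\<Sum>c<r. avail m c (map col zs) * (differ (col y) c * f c))"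
    if "P \<Longrightarrow> distinct zs" "P \<Longrightarrow> set zs \<subseteq> V" for P zs y f
  proof (cases P)
    case True
    then show ?thesis using S[of zs "\<lambda>c. differ (col y) c * f c"] that by (simp add: S_def differ_def of_bool_conj mult.assoc)
  qed simp
  define G5 where "G5 a b c d = (\<Sum>e<r. avail m e [d, c, b, a] * (differ d e * 1))" for a b c d
  define G4 where "G4 a b c = (\<Sum>d<r. avail m d [c, b, a] * (differ c d * G5 a b c d))" for a b c
  define G3 where "G3 a b = (\<Sum>c<r. avail m c [b, a] * (differ b c * G4 a b c))" for a b
  define G2 where "G2 a = (\<Sum>b<r. avail m b [a] * (differ a b * G3 a b))" for a
  let ?A = "\<lambda>x y. x \<in> V \<and> y \<in> V \<and> col x \<noteq> col y"
  have "real (card (paths5 ?A)) = (\<Sum>a\<in>V. \<Sum>b\<in>V. \<Sum>c\<in>V. \<Sum>d\<in>V. \<Sum>e\<in>V.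
      of_bool (?A a b \<and> ?A b c \<and> ?A c d \<and> ?A d e \<and> distinct [a, b, c, d, e]))"
    unfolding paths5_def by (rule card_5tuples[OF fin]) auto
  also have "\<dots> = real (\<Sum>a\<in>V. \<Sum>b\<in>V. \<Sum>c\<in>V. \<Sum>d\<in>V. \<Sum>e\<in>V.
      of_bool (?A a b \<and> ?A b c \<and> ?A c d \<and> ?A d e \<and> distinct [a, b, c, d, e]))"
    by (simp only: of_nat_sum of_nat_of_bool)
  \<comment> \<open>The conditions are nested so that each layer has the form that
    \<open>step\<close> removes; \<open>True\<close> is the empty condition on the first vertex. The
    lists grow at the front, so \<open>avail_rev\<close> has to turn them round at the end.\<close>
  also have "(\<Sum>a\<in>V. \<Sum>b\<in>V. \<Sum>c\<in>V. \<Sum>d\<in>V. \<Sum>e\<in>V.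
      of_bool (?A a b \<and> ?A b c \<and> ?A c d \<and> ?A d e \<and> distinct [a, b, c, d, e]) :: nat) =
    (\<Sum>a\<in>V. \<Sum>b\<in>V. \<Sum>c\<in>V. \<Sum>d\<in>V. \<Sum>e\<in>V.
      of_bool ((((True \<and> b \<notin> set [a] \<and> col a \<noteq> col b) \<and> c \<notin> set [b, a] \<and> col b \<noteq> col c) \<and> d \<notin> set [c, b, a] \<and> col c \<noteq> col d)
        \<and> e \<notin> set [d, c, b, a] \<and> col d \<noteq> col e) * 1)"
    by (intro sum.cong refl) auto
  also have "\<dots> = (\<Sum>a\<in>V. \<Sum>b\<in>V. \<Sum>c\<in>V. \<Sum>d\<in>V.
      of_bool (((True \<and> b \<notin> set [a] \<and> col a \<noteq> col b) \<and> c \<notin> set [b, a] \<and> col b \<noteq> col c) \<and> d \<notin> set [c, b, a] \<and> col c \<noteq> col d)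
        * G5 (col a) (col b) (col c) (col d))"
    by (intro sum.cong refl, subst step) (auto simp: G5_def)
  also have "\<dots> = (\<Sum>a\<in>V. \<Sum>b\<in>V. \<Sum>c\<in>V.
      of_bool ((True \<and> b \<notin> set [a] \<and> col a \<noteq> col b) \<and> c \<notin> set [b, a] \<and> col b \<noteq> col c) * G4 (col a) (col b) (col c))"
    by (intro sum.cong refl, subst step) (auto simp: G4_def)
  also have "\<dots> = (\<Sum>a\<in>V. \<Sum>b\<in>V. of_bool (True \<and> b \<notin> set [a] \<and> col a \<noteq> col b) * G3 (col a) (col b))"
    by (intro sum.cong refl, subst step) (auto simp: G3_def)
  also have "\<dots> = (\<Sum>a\<in>V. G2 (col a))"
    by (intro sum.cong refl, subst step) (auto simp: G2_def)
  also have "\<dots> = (\<Sum>a<r. avail m a [] * G2 a)"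
    using S[of "[]" G2] by (simp add: S_def)
  also have "\<dots> = mp_paths r m"
    unfolding mp_paths_def mp_term_def G2_def G3_def G4_def G5_def sum_distrib_left
    by (intro sum.cong refl) (simp only: avail_rev ac_simps mult_1_right)
  finally show ?thesis by simp
qed

section \<open>Balanced class sizes and extremal graphs\<close>

definition turan_size :: "nat \<Rightarrow> nat \<Rightarrow> nat \<Rightarrow> nat" where
  "turan_size r n i = n div r + (if i < n mod r then 1 else 0)"

lemma sum_turan_size:
  assumes "r > 0"
  shows "(\<Sum>i<r. turan_size r n i) = n"
proof -
  have "(\<Sum>x<n. 1) = (\<Sum>c<r. card {x \<in> {..<n}. x mod r = c})"
    using sum_by_class[of "{..<n}" "{}" "\<lambda>x. x mod r" r "\<lambda>_. 1"] assms by simp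
  also have "\<dots> = (\<Sum>i<r. turan_size r n i)"
    by (intro sum.cong refl) (simp add: turan_size_def card_residue_class)
  finally show ?thesis by simp
qed

lemma mp_paths_cong:
  assumes "\<And>i. i < r \<Longrightarrow> m i = m' i"
  shows "mp_paths r m = mp_paths r m'"
proof -
  have "avail m x ys = avail m' x ys" if "x < r" for x ys
    using that assms by (induction ys) (auto simp: avail.simps)
  then show ?thesis unfolding mp_paths_def mp_term_def by (intro sum.cong refl) simp
qed

text \<open>Induction on the total excess over the balanced sizes, where truncated subtraction
  counts only the classes that are too large. Each move from a class above its target to one below
  lowers it by one.\<close>

lemma mp_paths_le_turan:
  assumes r: "r > 0" and "(\<Sum>i<r. m i) = n"
  shows "mp_paths r m \<le> mp_paths r (turan_size r n)"
  using assms(2)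
proof (induction "\<Sum>i<r. m i - turan_size r n i" arbitrary: m rule: less_induct)
  case less
  let ?t = "turan_size r n"
  have eq: "(\<Sum>i<r. m i) = (\<Sum>i<r. ?t i)" using less.prems sum_turan_size[OF r] by simp
  show ?case
  proof (cases "\<exists>i<r. m i \<noteq> ?t i")
    case False
    then show ?thesis using mp_paths_cong[of r m ?t] by simp
  next
    case True
    have "\<exists>i<r. m i > ?t i"
    proof (rule ccontr)
      assume "\<not> ?thesis"
      then have le: "\<forall>i\<in>{..<r}. m i \<le> ?t i" by (meson lessThan_iff not_less)
      obtain i where "i < r" "m i \<noteq> ?t i" using True by blast
      with le have "\<exists>i\<in>{..<r}. m i < ?t i" by (metis le_neq_implies_less lessThan_iff)
      with le have "(\<Sum>i<r. m i) < (\<Sum>i<r. ?t i)" by (intro sum_strict_mono_ex1 finite_lessThan)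
      then show False using eq by simp
    qed
    then obtain i where i: "i < r" "m i > ?t i" by blast
    have "\<exists>j<r. m j < ?t j"
    proof (rule ccontr)
      assume "\<not> ?thesis"
      then have "\<forall>j\<in>{..<r}. ?t j \<le> m j" by (meson lessThan_iff not_less)
      moreover have "\<exists>i\<in>{..<r}. ?t i < m i" using i by blast
      ultimately have "(\<Sum>i<r. ?t i) < (\<Sum>i<r. m i)" by (intro sum_strict_mono_ex1 finite_lessThan)
      then show False using eq by simp
    qed
    then obtain j where j: "j < r" "m j < ?t j" by blast
    have ij: "i \<noteq> j" using i j by auto
    \<comment> \<open>Balanced sizes differ by at most one, so the move goes from a strictly larger
      class to a smaller one even if the targets are unequal.\<close>
    have "?t j \<le> ?t i + 1" by (simp add: turan_size_def)
    then have "m j < m i" using i j by simp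
    then have "mp_paths r m \<le> mp_paths r (m(i := m i - 1, j := m j + 1))"
      using mp_paths_move[of i r j m] i j ij by simp
    also have "\<dots> \<le> mp_paths r ?t"
    proof (rule less.hyps)
      let ?m = "m(i := m i - 1, j := m j + 1)"
      have split: "(\<Sum>x<r. f x) = f i + f j + (\<Sum>x\<in>{..<r} - {i} - {j}. f x)" for f :: "nat \<Rightarrow> nat"
        using i j ij by (subst sum.remove[of _ i]; (subst sum.remove[of _ j])?) auto
      have rest: "(\<Sum>x\<in>{..<r} - {i} - {j}. ?m x) = (\<Sum>x\<in>{..<r} - {i} - {j}. m x)"
        "(\<Sum>x\<in>{..<r} - {i} - {j}. ?m x - ?t x) = (\<Sum>x\<in>{..<r} - {i} - {j}. m x - ?t x)"
        by (auto intro!: sum.cong)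
      show "(\<Sum>x<r. ?m x - ?t x) < (\<Sum>x<r. m x - ?t x)"
        unfolding split rest using i j ij by simp
      show "(\<Sum>x<r. ?m x) = n"
        using less.prems i ij unfolding split rest by simp
    qed
    finally show ?thesis .
  qed
qed

text \<open>There are \<open>r * (r - 1)^4\<close> admissible colour sequences. Each class has at
  least \<open>n / r - 1\<close> vertices, at most four of them used before, so at least
  \<open>n / r - 5\<close> choices remain at every position.\<close>

lemma mp_paths_turan_ge:
  assumes r: "r \<ge> 2" and y: "y = real n / real r - 5" "y \<ge> 0"
  shows "real (mp_paths r (turan_size r n)) \<ge> real r * (real r - 1) ^ 4 * y ^ 5"
proof -
  let ?t = "turan_size r n"
  have tn: "y + 4 \<le> real (?t x)" for x
  proof -
    have "real n / real r \<le> real (n div r) + 1"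
    proof -
      have "n < (n div r + 1) * r" using dividend_less_div_times[of r n] r by simp
      then have "real n < (real (n div r) + 1) * real r" by (metis of_nat_1 of_nat_add of_nat_less_iff of_nat_mult)
      then show ?thesis using r by (simp add: divide_le_eq)
    qed
    then show ?thesis by (simp add: turan_size_def y)
  qed
  have avail_ge: "m x \<le> avail m x ys + length ys" for m x ys
    by (induction ys) (auto simp: avail.simps)
  have lf: "y \<le> real (avail ?t x ys)" if "length ys \<le> 4" for x ys
  proof -
    have "?t x \<le> avail ?t x ys + 4" using avail_ge[of ?t x ys] that by linarith
    then show ?thesis using tn[of x] by linarith
  qed
  have sd: "(\<Sum>c<r. real (differ b c) * z) = (real r - 1) * z" if "b < r" for b z
  proof -
    have "(\<Sum>c<r. real (differ b c)) = (\<Sum>c\<in>{..<r} - {b}. 1)"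
      by (rule sum.mono_neutral_cong_right) (auto simp: differ_def)
    then show ?thesis using that r by (simp add: sum_distrib_right[symmetric] of_nat_diff)
  qed
  have y5: "y ^ 5 = y * y * y * y * y" by (simp add: eval_nat_numeral)
  have "real r * (real r - 1) ^ 4 * y ^ 5 = (\<Sum>a<r. (real r - 1) * ((real r - 1) * ((real r - 1) * ((real r - 1) * y ^ 5))))"
    by (simp add: power4_eq_xxxx)
  also have "\<dots> = (\<Sum>a<r. \<Sum>b<r. real (differ a b) * (\<Sum>c<r. real (differ b c) * (\<Sum>d<r. real (differ c d) *
      (\<Sum>e<r. real (differ d e) * y ^ 5))))"
    by (simp add: sd)
  also have "\<dots> = (\<Sum>a<r. \<Sum>b<r. \<Sum>c<r. \<Sum>d<r. \<Sum>e<r. real (differ a b) * (real (differ b c) * (real (differ c d) *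
      (real (differ d e) * y ^ 5))))"
    by (simp only: sum_distrib_left)
  also have "\<dots> \<le> (\<Sum>a<r. \<Sum>b<r. \<Sum>c<r. \<Sum>d<r. \<Sum>e<r. real (mp_term ?t a b c d e))"
  proof (intro sum_mono)
    fix a b c d e
    have "y * y * y * y * y \<le> real (avail ?t a []) * real (avail ?t b [a]) * real (avail ?t c [a, b])
        * real (avail ?t d [a, b, c]) * real (avail ?t e [a, b, c, d])"
      by (intro mult_mono lf mult_nonneg_nonneg of_nat_0_le_iff y(2)) simp_all
    then have "real (differ a b) * real (differ b c) * real (differ c d) * real (differ d e) * y ^ 5
        \<le> real (differ a b) * real (differ b c) * real (differ c d) * real (differ d e) *
          (real (avail ?t a []) * real (avail ?t b [a]) * real (avail ?t c [a, b])
            * real (avail ?t d [a, b, c]) * real (avail ?t e [a, b, c, d]))"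
      unfolding y5 by (rule mult_left_mono) simp
    then show "real (differ a b) * (real (differ b c) * (real (differ c d) * (real (differ d e) * y ^ 5)))
        \<le> real (mp_term ?t a b c d e)"
      by (simp only: mp_term_def of_nat_mult mult.assoc)
  qed
  also have "\<dots> = real (mp_paths r ?t)" by (simp add: mp_paths_def)
  finally show ?thesis .
qed

section \<open>Extremal graphs are colourable\<close>

lemma paths5_mono: "(\<And>x y. A x y \<Longrightarrow> B x y) \<Longrightarrow> paths5 A \<subseteq> paths5 B"
  by (auto simp: paths5_def)

lemma card_paths5_colourable:
  assumes G: "graph_on V A" and r: "r > 0"
    and col: "\<And>v. v \<in> V \<Longrightarrow> col v < r" "\<And>u v. A u v \<Longrightarrow> col u \<noteq> col v"
  shows "card (paths5 A) \<le> mp_paths r (turan_size r (card V))"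
proof -
  have fin: "finite V" and AV: "A u v \<Longrightarrow> u \<in> V \<and> v \<in> V" for u v
    using G unfolding graph_on_def by blast+
  let ?B = "\<lambda>x y. x \<in> V \<and> y \<in> V \<and> col x \<noteq> col y"
  have "graph_on V ?B" using fin by (auto simp: graph_on_def)
  then have "card (paths5 A) \<le> card (paths5 ?B)"
    using AV col by (intro card_mono finite_paths5 paths5_mono) blast+
  also have "\<dots> = mp_paths r (\<lambda>c. card {x \<in> V. col x = c})"
    by (rule card_paths5_multipartite[OF fin col(1) refl])
  also have "\<dots> \<le> mp_paths r (turan_size r (card V))"
    using sum_by_class[of V "{}" col r "\<lambda>_. 1"] fin col(1) by (intro mp_paths_le_turan r) simp
  finally show ?thesis .
qed

lemma exists_extremal:
  assumes "graph_on V A" "cliques_le V A r"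
  shows "\<exists>B. graph_on V B \<and> cliques_le V B r \<and>
    (\<forall>C. graph_on V C \<longrightarrow> cliques_le V C r \<longrightarrow> card (paths5 C) \<le> card (paths5 B))"
proof -
  have "card (paths5 C) < Suc (card (V \<times> V \<times> V \<times> V \<times> V))" if C: "graph_on V C" for C
  proof -
    have "paths5 C \<subseteq> V \<times> V \<times> V \<times> V \<times> V" using paths5_subset[OF C] by auto
    moreover have "finite (V \<times> V \<times> V \<times> V \<times> V)" using C by (simp add: graph_on_def)
    ultimately show ?thesis using card_mono less_Suc_eq_le by blast
  qed
  then show ?thesis
    using ex_has_greatest_nat[of "\<lambda>B. graph_on V B \<and> cliques_le V B r" A "\<lambda>B. card (paths5 B)"] assms by blast
qed

text \<open>If an extremal graph had more paths than the Turan graph, the stability argument would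
  colour it, and then it could not. In \<open>large\<close>, the first summand makes the Turan count
  at least \<open>(1 - \<sigma>^4) * \<mu>^4 * n\<close>, the second absorbs the cubic error of
  cloning.\<close>

lemma card_paths5_le_turan:
  fixes \<sigma> :: real
  assumes G: "graph_on V A" and cl: "cliques_le V A r" and r: "r \<ge> 2"
    and s: "\<sigma> = 1 / (44 * real r ^ 3)"
    and large: "real (card V) \<ge> 25 * real r / \<sigma> ^ 4 + 320 / \<sigma>\<^sup>2"
  shows "card (paths5 A) \<le> mp_paths r (turan_size r (card V))"
proof -
  let ?n = "real (card V)" and ?T = "mp_paths r (turan_size r (card V))"
  obtain B where B: "graph_on V B" "cliques_le V B r"
    and ext: "\<And>C. graph_on V C \<Longrightarrow> cliques_le V C r \<Longrightarrow> card (paths5 C) \<le> card (paths5 B)"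
    using exists_extremal[OF G cl] by blast
  have r3: "real r ^ 3 \<ge> 1" using r by simp
  have s0: "\<sigma> > 0" "\<sigma> \<le> 1 / 44" using r r3 by (simp_all add: s divide_simps)
  have n1: "?n \<ge> 25 * real r / \<sigma> ^ 4" "?n \<ge> 320 / \<sigma>\<^sup>2"
  proof -
    have "25 * real r / \<sigma> ^ 4 \<ge> 0" "320 / \<sigma>\<^sup>2 \<ge> 0" using s0 by simp_all
    then show "?n \<ge> 25 * real r / \<sigma> ^ 4" "?n \<ge> 320 / \<sigma>\<^sup>2" using large by linarith+
  qed
  have n0: "card V > 0"
  proof -
    have "320 / \<sigma>\<^sup>2 > 0" using s0 by simp
    then show ?thesis using n1(2) by linarith
  qed
  define \<mu> where "\<mu> = (1 - 1 / real r) * ?n"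
  have \<rho>: "1 - 1 / real r \<ge> 1 / 2" "1 - 1 / real r \<le> 1" using r by (simp_all add: field_simps)
  have m0: "\<mu> > 0" unfolding \<mu>_def using \<rho> n0 by (intro mult_pos_pos) auto
  have "card (paths5 B) \<le> ?T"
  proof (rule ccontr)
    assume "\<not> ?thesis"
    then have gt: "real ?T \<le> card (paths5 B)" by simp
    have many: "(1 - \<sigma> ^ 4) * (\<mu> ^ 4 * ?n) \<le> card (paths5 B)"
    proof -
      \<comment> \<open>The relative loss in passing from \<open>n / r\<close> to
        \<open>n / r - 5\<close>; Bernoulli bounds the loss in the fifth power by
        \<open>5 * x\<close>.\<close>
      define x where "x = 5 * real r / ?n"
      have nr: "?n * \<sigma> ^ 4 \<ge> 25 * real r" using n1(1) s0 by (simp add: divide_le_eq)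
      have s4: "\<sigma> ^ 4 \<le> 1" using s0 by (intro power_le_one) auto
      have x: "5 * x \<le> \<sigma> ^ 4" using nr n0 by (simp add: x_def divide_le_eq mult.commute)
      have "1 - \<sigma> ^ 4 \<le> 1 + real 5 * (- x)" using x by simp
      also have "\<dots> \<le> (1 + (- x)) ^ 5" using x s4 by (intro Bernoulli_inequality) simp
      finally have "(1 - \<sigma> ^ 4) * (\<mu> ^ 4 * ?n) \<le> (1 - x) ^ 5 * (\<mu> ^ 4 * ?n)"
        using m0 by (intro mult_right_mono) auto
      also have "\<dots> = real r * (real r - 1) ^ 4 * (?n / real r - 5) ^ 5"
      proof -
        define c where "c = ?n / real r"
        have 1: "c - 5 = c * (1 - x)" "\<mu> = (real r - 1) * c" "?n = real r * c"
          using n0 r by (simp_all add: c_def x_def \<mu>_def field_simps)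
        have "c ^ 5 = c ^ 4 * c" by (simp add: eval_nat_numeral)
        then show ?thesis
          unfolding c_def[symmetric] 1(1,2) power_mult_distrib by (subst 1(3)) simp
      qed
      also have "\<dots> \<le> real ?T"
      proof (rule mp_paths_turan_ge[OF r refl])
        have "x \<le> 1" using x s4 by linarith
        then show "?n / real r - 5 \<ge> 0" using n0 r by (simp add: x_def field_simps)
      qed
      finally show ?thesis using gt by linarith
    qed
    \<comment> \<open>The coefficient 6 is \<open>5 + 1\<close>: five from the deficit
      \<open>\<sigma>^4 \<le> \<sigma>^2\<close> of the path count, one from the cloning
      error.\<close>
    have thr: "(5 - 6 * \<sigma>\<^sup>2) * \<mu> ^ 4 \<le> card (through B v)" if "v \<in> V" for v
    proof -
      have "5 * ((1 - \<sigma> ^ 4) * \<mu> ^ 4) \<le> 5 * real (card (paths5 B)) / ?n"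
        using many n0 by (simp add: le_divide_eq mult.assoc)
      moreover have "20 * ?n ^ 3 \<le> \<sigma>\<^sup>2 * \<mu> ^ 4"
      proof -
        \<comment> \<open>The constant is \<open>20 * 16\<close>, where 16 comes from
          \<open>\<mu> \<ge> n / 2\<close> in the fourth power.\<close>
        have "320 \<le> \<sigma>\<^sup>2 * ?n" using n1(2) s0 by (simp add: divide_le_eq mult.commute)
        then have "320 * (?n ^ 3 / 16) \<le> (\<sigma>\<^sup>2 * ?n) * (?n ^ 3 / 16)" by (intro mult_right_mono) auto
        also have "\<dots> = \<sigma>\<^sup>2 * ((1 / 2 * ?n) ^ 4)" by (simp add: power4_eq_xxxx power3_eq_cube)
        also have "\<dots> \<le> \<sigma>\<^sup>2 * \<mu> ^ 4"
          unfolding \<mu>_def using \<rho> by (intro mult_left_mono power_mono mult_right_mono) auto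
        finally show ?thesis by simp
      qed
      moreover have "\<sigma> ^ 4 * \<mu> ^ 4 \<le> \<sigma>\<^sup>2 * \<mu> ^ 4"
        using s0 by (intro mult_right_mono power_decreasing) auto
      moreover have "5 * real (card (paths5 B)) / ?n - 20 * ?n ^ 3 \<le> card (through B v)"
        by (rule through_of_extremal[OF B n0 ext that])
      ultimately show ?thesis by (simp add: algebra_simps)
    qed
    have deg: "(1 - 1 / real r - 1 / (4 * real r ^ 3)) * ?n \<le> card (nbrs V B v)" if "v \<in> V" for v
    proof -
      have "(1 - 11 * \<sigma>) * \<mu> \<le> real (card {u \<in> V. B v u})"
        by (rule min_degree_of_many_paths[OF B r n0 s0(1) _ \<mu>_def many that thr[OF that]]) (use s0 in simp)
      moreover have "11 * \<sigma> * \<mu> \<le> 11 * \<sigma> * ?n"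
        using s0 \<rho> by (simp add: \<mu>_def mult_left_le_one_le)
      moreover have "11 * \<sigma> * ?n = 1 / (4 * real r ^ 3) * ?n" by (simp add: s)
      moreover have "(1 - 11 * \<sigma>) * \<mu> = \<mu> - 11 * \<sigma> * \<mu>" by (simp add: algebra_simps)
      moreover have "(1 - 1 / real r - 1 / (4 * real r ^ 3)) * ?n = \<mu> - 1 / (4 * real r ^ 3) * ?n"
        by (simp add: \<mu>_def algebra_simps)
      ultimately show ?thesis unfolding nbrs_def by linarith
    qed
    obtain col :: "'a \<Rightarrow> nat" where "\<forall>v\<in>V. col v < r" "\<forall>u v. B u v \<longrightarrow> col u \<noteq> col v"
      using colourable_of_min_degree[OF B r n0 refl deg] by blast
    then show False using card_paths5_colourable[OF B(1), of r col] r \<open>\<not> card (paths5 B) \<le> ?T\<close> by auto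
  qed
  then show ?thesis using ext[OF G cl] by linarith
qed

section \<open>Copies of paths and complete graphs\<close>

definition adj :: "'a ugraph \<Rightarrow> 'a \<Rightarrow> 'a \<Rightarrow> bool" where
  "adj G x y \<longleftrightarrow> {x, y} \<in> edges G"

lemma graph_on_adj: "simple_graph G \<Longrightarrow> graph_on (verts G) (adj G)"
  unfolding graph_on_def simple_graph_def adj_def
  by (auto simp: insert_commute)

lemma clique_of_copy:
  assumes "S \<in> copies (complete_graph k) G"
  shows "verts S \<subseteq> verts G" "card (verts S) = k"
    "\<And>x y. x \<in> verts S \<Longrightarrow> y \<in> verts S \<Longrightarrow> x \<noteq> y \<Longrightarrow> adj G x y"
proof -
  from assms obtain f where f: "bij_betw f (verts S) {..<k}"
      "(\<lambda>e. f ` e) ` edges S = {e. e \<subseteq> {..<k} \<and> card e = 2}"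
    and S: "simple_graph S" "verts S \<subseteq> verts G" "edges S \<subseteq> edges G"
    by (auto simp: copies_def subgraph_def isomorphic_def complete_graph_def)
  show "verts S \<subseteq> verts G" by fact
  show "card (verts S) = k" using bij_betw_same_card[OF f(1)] by simp
  have inj: "inj_on f (verts S)" using f(1) by (rule bij_betw_imp_inj_on)
  fix x y assume xy: "x \<in> verts S" "y \<in> verts S" "x \<noteq> y"
  then have "f x \<noteq> f y" using inj by (auto simp: inj_on_def)
  then have "{f x, f y} \<in> (\<lambda>e. f ` e) ` edges S"
    unfolding f(2) using f(1) xy by (auto simp: bij_betw_def)
  then obtain e where e: "e \<in> edges S" "f ` e = f ` {x, y}" by auto
  then have "e \<subseteq> verts S" using S(1) by (auto simp: simple_graph_def)
  then have "e = {x, y}" using inj_on_image_eq_iff[OF inj, of e "{x, y}"] e(2) xy by blast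
  then show "adj G x y" using e(1) S(3) by (auto simp: adj_def)
qed

lemma copy_of_clique:
  assumes G: "simple_graph G" and X: "X \<subseteq> verts G" "card X = k" "finite X"
    and cl: "\<forall>x\<in>X. \<forall>y\<in>X. x \<noteq> y \<longrightarrow> adj G x y"
  shows "UGraph X {e. e \<subseteq> X \<and> card e = 2} \<in> copies (complete_graph k) G"
proof -
  obtain f where f: "bij_betw f X {..<k}"
    using ex_bij_betw_finite_nat[OF X(3)] X(2) by (metis atLeast0LessThan)
  then have inj: "inj_on f X" and im: "f ` X = {..<k}" by (auto simp: bij_betw_def)
  have "(\<lambda>e. f ` e) ` {e. e \<subseteq> X \<and> card e = 2} = {e. e \<subseteq> {..<k} \<and> card e = 2}"
  proof safe
    fix e x assume "e \<subseteq> X" "x \<in> e"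
    then show "f x < k" using im by blast
  next
    fix e assume "e \<subseteq> X" "card e = 2"
    then show "card (f ` e) = 2" using inj by (metis card_image inj_on_subset)
  next
    fix e assume e: "e \<subseteq> {..<k}" "card e = 2"
    then obtain d where d: "d \<subseteq> X" "e = f ` d" by (metis im subset_image_iff)
    then have "card d = 2" using e(2) inj by (metis card_image inj_on_subset)
    then show "e \<in> (\<lambda>e. f ` e) ` {e. e \<subseteq> X \<and> card e = 2}" using d by blast
  qed
  then have "isomorphic (UGraph X {e. e \<subseteq> X \<and> card e = 2}) (complete_graph k)"
    using f unfolding isomorphic_def complete_graph_def by auto
  moreover have "e \<in> edges G" if "e \<subseteq> X" "card e = 2" for e
    using that cl unfolding adj_def by (metis card_2_iff insert_subset)
  ultimately show ?thesis
    using X by (auto simp: copies_def subgraph_def simple_graph_def)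
qed

lemma free_of_complete_iff:
  assumes G: "simple_graph G" and k: "k > 0"
  shows "free_of (complete_graph k) G \<longleftrightarrow> cliques_le (verts G) (adj G) (k - 1)"
proof
  assume free: "free_of (complete_graph k) G"
  show "cliques_le (verts G) (adj G) (k - 1)"
    unfolding cliques_le_def
  proof (intro allI impI, rule ccontr)
    fix X assume X: "X \<subseteq> verts G" "\<forall>x\<in>X. \<forall>y\<in>X. x \<noteq> y \<longrightarrow> adj G x y" "\<not> card X \<le> k - 1"
    then obtain Y where Y: "Y \<subseteq> X" "card Y = k" "finite Y"
      using obtain_subset_with_card_n[of k X] by (metis Suc_leI Suc_pred' k not_le)
    then show False using copy_of_clique[OF G, of Y k] X free unfolding free_of_def by blast
  qed
next
  assume cl: "cliques_le (verts G) (adj G) (k - 1)"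
  show "free_of (complete_graph k) G"
    unfolding free_of_def
  proof (rule ccontr)
    assume "copies (complete_graph k) G \<noteq> {}"
    then obtain S where S: "S \<in> copies (complete_graph k) G" by blast
    note c = clique_of_copy[OF S]
    then have "card (verts S) \<le> k - 1" using cl unfolding cliques_le_def by blast
    then show False using c(2) k by simp
  qed
qed

section \<open>Ordered five-vertex paths and copies of the path\<close>

definition path_of :: "'a \<times> 'a \<times> 'a \<times> 'a \<times> 'a \<Rightarrow> 'a ugraph" where
  "path_of = (\<lambda>(a, b, c, d, e). UGraph {a, b, c, d, e} {{a, b}, {b, c}, {c, d}, {d, e}})"

lemma path_graph_5: "path_graph 5 = UGraph {..<5} {{0, 1}, {1, 2}, {2, 3}, {3, 4}}"
proof -
  have "{{i, Suc i} | i. Suc i < 5} = (\<lambda>i. {i, Suc i}) ` {i. Suc i < 5}" by blast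
  also have "{i. Suc i < 5} = {0, 1, 2, 3}" by auto
  also have "(\<lambda>i. {i, Suc i}) ` \<dots> = {{0, 1}, {1, 2}, {2, 3}, {3, 4 :: nat}}"
  proof -
    have "Suc 0 = 1" "Suc 1 = 2" "Suc 2 = 3" "Suc 3 = 4" by simp_all
    then show ?thesis by (simp only: image_insert image_empty)
  qed
  finally show ?thesis by (simp only: path_graph_def)
qed

lemma lessThan5: "{..<5} = {0, 1, 2, 3, 4 :: nat}"
  by auto

lemma copies_path5:
  assumes G: "simple_graph G"
  shows "copies (path_graph 5) G = path_of ` paths5 (adj G)"
proof
  show "path_of ` paths5 (adj G) \<subseteq> copies (path_graph 5) G"
  proof
    fix S assume "S \<in> path_of ` paths5 (adj G)"
    then obtain a b c d e where t: "(a, b, c, d, e) \<in> paths5 (adj G)"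
      and S: "S = UGraph {a, b, c, d, e} {{a, b}, {b, c}, {c, d}, {d, e}}"
      by (auto simp: path_of_def)
    have dist: "distinct [a, b, c, d, e]" and E: "{{a, b}, {b, c}, {c, d}, {d, e}} \<subseteq> edges G"
      using t by (auto simp: paths5_def adj_def)
    have V: "{a, b, c, d, e} \<subseteq> verts G" using paths5_subset[OF graph_on_adj[OF G] t] .
    define f where "f = (\<lambda>x. if x = a then 0 else if x = b then 1 else if x = c then 2 else if x = d then 3 else 4 :: nat)"
    have fv: "f a = 0" "f b = 1" "f c = 2" "f d = 3" "f e = 4"
      using dist by (auto simp: f_def)
    have "bij_betw f (verts S) (verts (path_graph 5))"
      unfolding bij_betw_def path_graph_5 S using fv
      by (auto simp: lessThan5 inj_on_def)
    moreover have "(\<lambda>e. f ` e) ` edges S = edges (path_graph 5)"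
      unfolding path_graph_5 S using fv by simp
    ultimately have "isomorphic S (path_graph 5)" unfolding isomorphic_def by blast
    moreover have "subgraph S G"
      using V E dist by (auto simp: S subgraph_def simple_graph_def)
    ultimately show "S \<in> copies (path_graph 5) G" by (simp add: copies_def)
  qed
  show "copies (path_graph 5) G \<subseteq> path_of ` paths5 (adj G)"
  proof
    fix S assume "S \<in> copies (path_graph 5) G"
    then obtain f where f: "bij_betw f (verts S) {..<5}" "(\<lambda>e. f ` e) ` edges S = {{0, 1}, {1, 2}, {2, 3}, {3, 4 :: nat}}"
      and S: "simple_graph S" "edges S \<subseteq> edges G"
      by (auto simp: copies_def subgraph_def isomorphic_def path_graph_5)
    \<comment> \<open>The inverse isomorphism lists the vertices of \<open>S\<close> in path order,
      which is the tuple wanted.\<close>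
    define g where "g = inv_into (verts S) f"
    have g: "bij_betw g {..<5} (verts S)" unfolding g_def by (rule bij_betw_inv_into[OF f(1)])
    have gf: "g ` f ` e = e" if "e \<in> edges S" for e
    proof -
      have "e \<subseteq> verts S" using that S(1) by (auto simp: simple_graph_def)
      then show ?thesis using inv_into_image_cancel[of f "verts S" e] f(1) by (simp add: g_def bij_betw_def)
    qed
    have "edges S = (\<lambda>e. g ` e) ` (\<lambda>e. f ` e) ` edges S"
      using gf by (simp add: image_image)
    then have eS: "edges S = {{g 0, g 1}, {g 1, g 2}, {g 2, g 3}, {g 3, g 4}}" unfolding f(2) by simp
    have vS: "verts S = {g 0, g 1, g 2, g 3, g 4}" using g by (auto simp: bij_betw_def lessThan5)
    have "inj_on g {0, 1, 2, 3, 4}" using g by (simp add: bij_betw_def lessThan5)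
    then have "distinct [g 0, g 1, g 2, g 3, g 4]" by (simp add: inj_on_def)
    then have "(g 0, g 1, g 2, g 3, g 4) \<in> paths5 (adj G)"
      using eS S(2) by (auto simp: paths5_def adj_def)
    moreover have "S = path_of (g 0, g 1, g 2, g 3, g 4)"
      using eS vS by (cases S) (simp add: path_of_def)
    ultimately show "S \<in> path_of ` paths5 (adj G)" by blast
  qed
qed

text \<open>Vertices two apart are distinct, so the second tuple never turns back; with four edges
  at its disposal it must run through the path from one end to the other.\<close>

lemma path_of_eq:
  assumes "distinct [a, b, c, d, e]" "distinct [a', b', c', d', e']"
    and "{{a', b'}, {b', c'}, {c', d'}, {d', e'}} = {{a, b}, {b, c}, {c, d}, {d, e}}"
  shows "(a', b', c', d', e') \<in> {(a, b, c, d, e), (e, d, c, b, a)}"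
proof -
  have 1: "{a', b'} \<in> {{a, b}, {b, c}, {c, d}, {d, e}}" "{b', c'} \<in> {{a, b}, {b, c}, {c, d}, {d, e}}"
    "{c', d'} \<in> {{a, b}, {b, c}, {c, d}, {d, e}}" "{d', e'} \<in> {{a, b}, {b, c}, {c, d}, {d, e}}"
    unfolding assms(3)[symmetric] by simp_all
  have D: "x = a \<and> y = b \<or> x = b \<and> y = a \<or> x = b \<and> y = c \<or> x = c \<and> y = b \<or>
      x = c \<and> y = d \<or> x = d \<and> y = c \<or> x = d \<and> y = e \<or> x = e \<and> y = d"
    if "{x, y} \<in> {{a, b}, {b, c}, {c, d}, {d, e}}" for x y
    using that unfolding insert_iff empty_iff doubleton_eq_iff by argo
  have ne: "a \<noteq> b" "b \<noteq> a" "a \<noteq> c" "c \<noteq> a" "a \<noteq> d" "d \<noteq> a" "a \<noteq> e" "e \<noteq> a" "b \<noteq> c" "c \<noteq> b" "b \<noteq> d" "d \<noteq> b"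
    "b \<noteq> e" "e \<noteq> b" "c \<noteq> d" "d \<noteq> c" "c \<noteq> e" "e \<noteq> c" "d \<noteq> e" "e \<noteq> d"
    using assms(1) by auto
  have ne': "a' \<noteq> c'" "b' \<noteq> d'" "c' \<noteq> e'" using assms(2) by auto

  \<comment> \<open>The first edge has eight oriented positions, and each fixes the next edges in
    turn. All but the two that start at an end of the path and lead inwards run into an end too
    early and contradict \<open>ne'\<close>.\<close>
  show ?thesis
    using D[OF 1(1)] ne'
    by (elim disjE conjE; use D[OF 1(2)] in \<open>simp add: ne\<close>; use D[OF 1(3)] in \<open>simp add: ne\<close>; use D[OF 1(4)] in \<open>simp add: ne\<close>)
qed

lemma path_of_rev: "path_of (a, b, c, d, e) = path_of (e, d, c, b, a)"
proof -
  have "{a, b, c, d, e} = {e, d, c, b, a}" by blast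
  moreover have "{{a, b}, {b, c}, {c, d}, {d, e}} = {{e, d}, {d, c}, {c, b}, {b, a}}"
    unfolding insert_commute[of a b "{}"] insert_commute[of b c "{}"] insert_commute[of c d "{}"]
      insert_commute[of d e "{}"] by blast
  ultimately show ?thesis by (simp only: path_of_def prod.case)
qed

text \<open>Each fibre of \<open>path_of\<close> consists of a tuple and its reverse, which differ
  because the entries are distinct.\<close>

lemma card_copies_path5:
  assumes G: "simple_graph G"
  shows "card (paths5 (adj G)) = 2 * num_copies (path_graph 5) G"
proof -
  let ?P = "paths5 (adj G)"
  have fin: "finite ?P" by (rule finite_paths5[OF graph_on_adj[OF G]])
  have sym: "adj G x y \<Longrightarrow> adj G y x" for x y by (simp add: adj_def insert_commute)
  have fibre: "card {t \<in> ?P. path_of t = S} = 2" if "S \<in> path_of ` ?P" for S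
  proof -
    obtain a b c d e where t: "(a, b, c, d, e) \<in> ?P" and S: "S = path_of (a, b, c, d, e)"
      using \<open>S \<in> path_of ` ?P\<close> by auto
    have dist: "distinct [a, b, c, d, e]" using t by (simp add: paths5_def)
    have rev: "(e, d, c, b, a) \<in> ?P" using t sym[of a b] sym[of b c] sym[of c d] sym[of d e] by (auto simp: paths5_def)
    have "{t \<in> ?P. path_of t = S} = {(a, b, c, d, e), (e, d, c, b, a)}"
    proof
      show "{t \<in> ?P. path_of t = S} \<subseteq> {(a, b, c, d, e), (e, d, c, b, a)}"
      proof
        fix t assume "t \<in> {t \<in> ?P. path_of t = S}"
        then have t': "t \<in> ?P" "path_of t = S" by simp_all
        obtain a' b' c' d' e' where eq: "t = (a', b', c', d', e')" by (cases t)
        have "distinct [a', b', c', d', e']" using t'(1) by (simp add: eq paths5_def)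
        moreover have "edges (path_of t) = edges S" using t'(2) by simp
        ultimately show "t \<in> {(a, b, c, d, e), (e, d, c, b, a)}"
          unfolding eq S path_of_def prod.case ugraph.sel by (rule path_of_eq[OF dist])
      qed
      show "{(a, b, c, d, e), (e, d, c, b, a)} \<subseteq> {t \<in> ?P. path_of t = S}"
        using t rev path_of_rev[of e d c b a] by (simp add: S)
    qed
    then show ?thesis using dist by simp
  qed
  have "card ?P = (\<Sum>t\<in>?P. 1)" by simp
  also have "\<dots> = (\<Sum>S\<in>path_of ` ?P. \<Sum>t\<in>{t \<in> ?P. path_of t = S}. 1)" by (rule sum.image_gen[OF fin])
  also have "\<dots> = (\<Sum>S\<in>path_of ` ?P. 2)" using fibre by simp
  finally show ?thesis by (simp add: num_copies_def copies_path5[OF G])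
qed

section \<open>The Turan graph and the conclusion\<close>

lemma adj_turan_graph: "adj (turan_graph r n) x y \<longleftrightarrow> x < n \<and> y < n \<and> x mod r \<noteq> y mod r"
  unfolding adj_def turan_graph_def by (auto simp: doubleton_eq_iff)

lemma simple_turan_graph: "simple_graph (turan_graph r n)"
  by (auto simp: simple_graph_def turan_graph_def card_2_iff)

lemma turan_graph_free:
  assumes "k \<ge> 2"
  shows "free_of (complete_graph k) (turan_graph (k - 1) n)"
proof -
  have "cliques_le (verts (turan_graph (k - 1) n)) (adj (turan_graph (k - 1) n)) (k - 1)"
    unfolding cliques_le_def
  proof (intro allI impI)
    fix X assume "\<forall>x\<in>X. \<forall>y\<in>X. x \<noteq> y \<longrightarrow> adj (turan_graph (k - 1) n) x y"
    then have "inj_on (\<lambda>x. x mod (k - 1)) X" unfolding adj_turan_graph inj_on_def by blast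
    moreover have "(\<lambda>x. x mod (k - 1)) ` X \<subseteq> {..<k - 1}" using assms by auto
    ultimately show "card X \<le> k - 1" using card_inj_on_le[of _ X "{..<k - 1}"] by simp
  qed
  then show ?thesis using free_of_complete_iff[OF simple_turan_graph] assms by simp
qed

lemma num_copies_turan_graph:
  assumes "r > 0"
  shows "2 * num_copies (path_graph 5) (turan_graph r n) = mp_paths r (turan_size r n)"
proof -
  have "2 * num_copies (path_graph 5) (turan_graph r n) = card (paths5 (adj (turan_graph r n)))"
    by (rule card_copies_path5[OF simple_turan_graph, symmetric])
  also have "adj (turan_graph r n) = (\<lambda>x y. x \<in> {..<n} \<and> y \<in> {..<n} \<and> x mod r \<noteq> y mod r)"
    by (intro ext) (simp add: adj_turan_graph)
  also have "card (paths5 \<dots>) = mp_paths r (\<lambda>c. card {x \<in> {..<n}. x mod r = c})"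
    by (rule card_paths5_multipartite) (use assms in auto)
  also have "\<dots> = mp_paths r (turan_size r n)"
    by (rule mp_paths_cong) (simp add: turan_size_def card_residue_class)
  finally show ?thesis .
qed

lemma path_graph_free:
  assumes "k \<ge> 5"
  shows "free_of (complete_graph k) (path_graph 5)"
proof -
  have simple: "simple_graph (path_graph 5)"
    unfolding path_graph_5 by (auto simp: simple_graph_def)
  have "cliques_le (verts (path_graph 5)) (adj (path_graph 5)) (k - 1)"
    unfolding cliques_le_def
  proof (intro allI impI, rule ccontr)
    fix X assume X: "X \<subseteq> verts (path_graph 5)" "\<forall>x\<in>X. \<forall>y\<in>X. x \<noteq> y \<longrightarrow> adj (path_graph 5) x y"
      "\<not> card X \<le> k - 1"
    \<comment> \<open>A clique of at least five vertices would be the whole vertex set, but 0 and 2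
      are not adjacent.\<close>
    have "X \<subseteq> {..<5}" "card {..<5 :: nat} \<le> card X" using X(1,3) assms by (auto simp: path_graph_5)
    then have "X = {..<5}" by (intro card_seteq) auto
    then have "adj (path_graph 5) 0 2" using X(2) by auto
    then show False by (simp add: adj_def path_graph_5 doubleton_eq_iff)
  qed
  then show ?thesis using free_of_complete_iff[OF simple] assms by simp
qed

theorem theorem4p3:
  fixes k :: nat
  assumes "k \<ge> 5"
  shows "turan_good k (path_graph 5)"
  unfolding turan_good_def
proof
  show "free_of (complete_graph k) (path_graph 5)" by (rule path_graph_free[OF assms])
  define r where "r = k - 1"
  define \<sigma> where "\<sigma> = 1 / (44 * real r ^ 3)"
  have r: "r \<ge> 2" using assms by (simp add: r_def)
  have "\<forall>\<^sub>F n in sequentially. real n \<ge> 25 * real r / \<sigma> ^ 4 + 320 / \<sigma>\<^sup>2"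
    using filterlim_real_sequentially by (simp add: filterlim_at_top)
  then show "\<forall>\<^sub>F n in sequentially. ex_num n (path_graph 5) (complete_graph k) =
      num_copies (path_graph 5) (turan_graph (k - 1) n)"
  proof (rule eventually_mono)
    fix n assume large: "real n \<ge> 25 * real r / \<sigma> ^ 4 + 320 / \<sigma>\<^sup>2"
    show "ex_num n (path_graph 5) (complete_graph k) = num_copies (path_graph 5) (turan_graph (k - 1) n)"
      unfolding ex_num_def
    proof (rule Max_eqI[OF finite_ex_num_values])
      show "num_copies (path_graph 5) (turan_graph (k - 1) n)
          \<in> {num_copies (path_graph 5) G | G :: nat ugraph.
            simple_graph G \<and> card (verts G) = n \<and> free_of (complete_graph k) G}"
        using simple_turan_graph[of "k - 1" n] turan_graph_free[of k n] assms
        by (intro CollectI exI[of _ "turan_graph (k - 1) n"]) (simp add: turan_graph_def)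
    next
      fix N assume "N \<in> {num_copies (path_graph 5) G | G :: nat ugraph.
            simple_graph G \<and> card (verts G) = n \<and> free_of (complete_graph k) G}"
      then obtain G :: "nat ugraph" where N: "N = num_copies (path_graph 5) G"
        and G: "simple_graph G" "card (verts G) = n" "free_of (complete_graph k) G" by blast
      have "cliques_le (verts G) (adj G) r"
        using free_of_complete_iff[OF G(1)] G(3) assms by (simp add: r_def)
      from card_paths5_le_turan[OF graph_on_adj[OF G(1)] this r \<sigma>_def] large
      have "card (paths5 (adj G)) \<le> mp_paths r (turan_size r n)" by (simp add: G(2))
      \<comment> \<open>Both numbers of ordered paths are twice the numbers of copies, so the factor
        cancels.\<close>
      then show "N \<le> num_copies (path_graph 5) (turan_graph (k - 1) n)"
        using card_copies_path5[OF G(1)] num_copies_turan_graph[of r n] r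
        unfolding N r_def[symmetric] by linarith
    qed
  qed
qed

end
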